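(* Let $\Gamma$ be a finite (nonempty) simplicial graph, and let $A(\Gamma)$ be the associated right-angled Artin group. Then $A(\Gamma)$ splits nontrivially over an abelian group if and only if at least one of the following holds: (1) $\Gamma$ is disconnected; (2) $\Gamma$ is a complete graph; (3) $\Gamma$ contains a separating clique.
   Context: For a simplicial graph $\Gamma$ with vertex set $V(\Gamma)$ and edge set $E(\Gamma)$, the right-angled Artin group is $$A(\Gamma)=\langle V(\Gamma)\mid [u,v]=1 \text{ whenever } (u,v)\in E(\Gamma)\rangle.$$ A clique in $\Gamma$ is a complete subgraph (a set of pairwise adjacent vertices together with all edges between them); a single vertex is a clique, and the graph with one vertex is a complete graph. A clique $K$ is separating if the subgraph $\Gamma\smallsetminus K$ induced by the vertices not in $K$ is disconnected (i.e. it is the disjoint union of two nonempty subgraphs with no edge between them). A group $G$ splits nontrivially over an abelian group if there is an abelian subgroup $C\le G$ such that either $G=A*_C B$ with $C\neq A$ and $C\neq B$, or $G$ is an HNN extension $A*_C$. Equivalently (by Bass–Serre theory), $G$ being finitely generated, $G$ acts without inversions on a simplicial tree with abelian edge stabilizers and with no global fixed point. The abelian group $C$ is allowed to be trivial. *)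

theory Defs
  imports "HOL-Algebra.Group" "Graph_Theory.Graph_Theory"
begin

section \<open>Groups given by generators and relators\<close>

text \<open>
  A letter \<open>(x, True)\<close> stands for the generator \<open>x\<close> and \<open>(x, False)\<close> for its formal inverse.
\<close>

type_synonym 'a word = "('a \<times> bool) list"

definition words :: "'a set \<Rightarrow> 'a word set" where
  "words S = lists (S \<times> UNIV)"

text \<open>
  One step inserts a relator or a cancelling pair at an arbitrary position of a word. Two words
  over \<open>S\<close> represent the same element of the group presented by \<open>S\<close> and \<open>R\<close> iff they are related
  by the equivalence relation generated by these steps.
\<close>

definition pres_step :: "'a set \<Rightarrow> 'a word set \<Rightarrow> ('a word \<times> 'a word) set" where
  "pres_step S R =
     {(u @ v, u @ r @ v) | u r v. u \<in> words S \<and> v \<in> words S \<and>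
        (r \<in> R \<inter> words S \<or> (\<exists>x\<in>S. \<exists>b. r = [(x, b), (x, \<not> b)]))}"

definition pres_rel :: "'a set \<Rightarrow> 'a word set \<Rightarrow> ('a word \<times> 'a word) set" where
  "pres_rel S R = (pres_step S R \<union> (pres_step S R)\<inverse>)\<^sup>* \<inter> words S \<times> words S"

definition presented_group :: "'a set \<Rightarrow> 'a word set \<Rightarrow> 'a word set monoid" where
  "presented_group S R =
     \<lparr> carrier = words S // pres_rel S R,
       monoid.mult = (\<lambda>X Y. \<Union>u\<in>X. \<Union>v\<in>Y. pres_rel S R `` {u @ v}),
       one = pres_rel S R `` {[]} \<rparr>"

definition pres_gen :: "'a set \<Rightarrow> 'a word set \<Rightarrow> 'a \<Rightarrow> 'a word set" where
  "pres_gen S R x = pres_rel S R `` {[(x, True)]}"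

lemma words_Nil [simp]: "[] \<in> words S"
  by (simp add: words_def)

lemma words_append [simp]: "u @ v \<in> words S \<longleftrightarrow> u \<in> words S \<and> v \<in> words S"
  by (auto simp: words_def)

lemma words_Cons [simp]: "(x, b) # v \<in> words S \<longleftrightarrow> x \<in> S \<and> v \<in> words S"
  by (auto simp: words_def)

lemma pres_step_words: "(u, v) \<in> pres_step S R \<Longrightarrow> u \<in> words S \<and> v \<in> words S"
  by (auto simp: pres_step_def)

lemma pres_step_context:
  assumes "(u, v) \<in> pres_step S R" "p \<in> words S" "q \<in> words S"
  shows "(p @ u @ q, p @ v @ q) \<in> pres_step S R"
proof -
  from assms(1) obtain a r b where uv: "u = a @ b" "v = a @ r @ b" "a \<in> words S" "b \<in> words S"
    and r: "r \<in> R \<inter> words S \<or> (\<exists>x\<in>S. \<exists>b. r = [(x, b), (x, \<not> b)])"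
    unfolding pres_step_def by blast
  have "p @ u @ q = (p @ a) @ (b @ q)" "p @ v @ q = (p @ a) @ r @ (b @ q)"
    using uv by simp_all
  moreover have "p @ a \<in> words S" "b @ q \<in> words S" using uv assms by auto
  ultimately show ?thesis using r unfolding pres_step_def by blast
qed

lemma equiv_pres_rel: "equiv (words S) (pres_rel S R)"
proof (rule equivI)
  show "pres_rel S R \<subseteq> words S \<times> words S" by (auto simp: pres_rel_def)
  show "refl_on (words S) (pres_rel S R)" by (auto simp: pres_rel_def refl_on_def)
  have "sym ((pres_step S R \<union> (pres_step S R)\<inverse>)\<^sup>*)"
    by (intro sym_rtrancl sym_Un_converse)
  then show "sym (pres_rel S R)" unfolding pres_rel_def by (auto simp: sym_def)
  show "trans (pres_rel S R)" unfolding pres_rel_def trans_def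
    by (blast intro: rtrancl_trans)
qed

lemma pres_rel_context:
  assumes "(u, v) \<in> pres_rel S R" "p \<in> words S" "q \<in> words S"
  shows "(p @ u @ q, p @ v @ q) \<in> pres_rel S R"
proof -
  let ?T = "pres_step S R \<union> (pres_step S R)\<inverse>"
  have uv: "(u, v) \<in> ?T\<^sup>*" "u \<in> words S" "v \<in> words S"
    using assms(1) by (auto simp: pres_rel_def)
  from uv(1) have "(p @ u @ q, p @ v @ q) \<in> ?T\<^sup>*"
  proof induction
    case (step y z)
    then have "(p @ y @ q, p @ z @ q) \<in> ?T"
      using pres_step_context assms(2,3) by blast
    with step.IH show ?case by (rule rtrancl_into_rtrancl)
  qed simp
  then show ?thesis using uv assms by (auto simp: pres_rel_def)
qed

lemma pres_rel_append:
  assumes "(u, u') \<in> pres_rel S R" "(v, v') \<in> pres_rel S R"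
  shows "(u @ v, u' @ v') \<in> pres_rel S R"
proof -
  have w: "u' \<in> words S" "v \<in> words S" using assms by (auto simp: pres_rel_def)
  have "(u @ v, u' @ v) \<in> pres_rel S R"
    using pres_rel_context[OF assms(1), of "[]" v] w by simp
  moreover have "(u' @ v, u' @ v') \<in> pres_rel S R"
    using pres_rel_context[OF assms(2), of u' "[]"] w by simp
  ultimately show ?thesis
    using equiv_pres_rel[of S R] by (meson equivE transE)
qed

lemma presented_group_mult:
  assumes "u \<in> words S" "v \<in> words S"
  shows "pres_rel S R `` {u} \<otimes>\<^bsub>presented_group S R\<^esub> pres_rel S R `` {v} = pres_rel S R `` {u @ v}"
proof -
  have "congruent2 (pres_rel S R) (pres_rel S R) (\<lambda>u v. pres_rel S R `` {u @ v})"
    unfolding congruent2_def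
    using equiv_class_eq[OF equiv_pres_rel] pres_rel_append by blast
  then show ?thesis
    using UN_equiv_class2[OF equiv_pres_rel equiv_pres_rel] assms
    by (simp add: presented_group_def)
qed

definition word_inv :: "'a word \<Rightarrow> 'a word" where
  "word_inv u = rev (map (\<lambda>(x, b). (x, \<not> b)) u)"

lemma word_inv_words: "u \<in> words S \<Longrightarrow> word_inv u \<in> words S"
  by (auto simp: words_def word_inv_def)

lemma pres_rel_word_inv:
  "u \<in> words S \<Longrightarrow> (word_inv u @ u, []) \<in> pres_rel S R"
proof (induction u)
  case Nil
  then show ?case by (simp add: word_inv_def pres_rel_def)
next
  case (Cons a u)
  obtain x b where a: "a = (x, b)" by (cases a)
  have x: "x \<in> S" and u: "u \<in> words S" using Cons.prems a by auto
  have "([], [(x, \<not> b), (x, b)]) \<in> pres_step S R"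
    unfolding pres_step_def mem_Collect_eq
    by (rule exI[of _ "[]"], rule exI[of _ "[(x, \<not> b), (x, b)]"], rule exI[of _ "[]"])
       (use x in auto)
  then have "([(x, \<not> b), (x, b)], []) \<in> pres_rel S R"
    using x by (auto simp: pres_rel_def)
  then have "(word_inv u @ [(x, \<not> b), (x, b)] @ u, word_inv u @ [] @ u) \<in> pres_rel S R"
    using u word_inv_words by (intro pres_rel_context) auto
  moreover have "word_inv (a # u) @ a # u = word_inv u @ [(x, \<not> b), (x, b)] @ u"
    by (simp add: a word_inv_def)
  ultimately show ?case
    using Cons.IH[OF u] equiv_pres_rel[of S R] by (metis append_Nil equivE transE)
qed

lemma group_presented_group: "group (presented_group S R)"
proof (rule groupI)
  let ?G = "presented_group S R" and ?c = "\<lambda>u. pres_rel S R `` {u}"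
  have car: "carrier ?G = words S // pres_rel S R" and one: "\<one>\<^bsub>?G\<^esub> = ?c []"
    by (simp_all add: presented_group_def)
  have classE: "\<exists>u\<in>words S. X = ?c u" if "X \<in> carrier ?G" for X
    using that unfolding car by (auto elim: quotientE)
  have classI: "?c u \<in> carrier ?G" if "u \<in> words S" for u
    using that unfolding car by (rule quotientI)
  show "\<one>\<^bsub>?G\<^esub> \<in> carrier ?G" unfolding one by (rule classI) simp
  fix X assume "X \<in> carrier ?G"
  then obtain u where u: "u \<in> words S" "X = ?c u" using classE by blast
  show "\<one>\<^bsub>?G\<^esub> \<otimes>\<^bsub>?G\<^esub> X = X"
    unfolding one u(2) using presented_group_mult[of "[]" S u R] u by simp
  have "?c (word_inv u) \<otimes>\<^bsub>?G\<^esub> X = \<one>\<^bsub>?G\<^esub>"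
    unfolding one u(2) presented_group_mult[OF word_inv_words[OF u(1)] u(1)]
    by (rule equiv_class_eq[OF equiv_pres_rel pres_rel_word_inv[OF u(1)]])
  then show "\<exists>Y\<in>carrier ?G. Y \<otimes>\<^bsub>?G\<^esub> X = \<one>\<^bsub>?G\<^esub>"
    using classI[OF word_inv_words[OF u(1)]] by blast
  fix Y assume "Y \<in> carrier ?G"
  then obtain v where v: "v \<in> words S" "Y = ?c v" using classE by blast
  show "X \<otimes>\<^bsub>?G\<^esub> Y \<in> carrier ?G"
    using presented_group_mult[OF u(1) v(1), of R] classI u v by simp
  fix Z assume "Z \<in> carrier ?G"
  then obtain w where w: "w \<in> words S" "Z = ?c w" using classE by blast
  show "X \<otimes>\<^bsub>?G\<^esub> Y \<otimes>\<^bsub>?G\<^esub> Z = X \<otimes>\<^bsub>?G\<^esub> (Y \<otimes>\<^bsub>?G\<^esub> Z)"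
    by (simp add: u v w presented_group_mult)
qed


section \<open>Amalgamated free products and HNN extensions\<close>

text \<open>
  The relators \<open>x y (xy)\<inverse>\<close> of the multiplication table of \<open>A\<close>, with the elements of \<open>A\<close>
  named by \<open>\<iota>\<close>.
\<close>

definition mult_table :: "('a \<Rightarrow> 'g) \<Rightarrow> ('a, 'm) monoid_scheme \<Rightarrow> 'g word set" where
  "mult_table \<iota> A =
     {[(\<iota> x, True), (\<iota> y, True), (\<iota> (x \<otimes>\<^bsub>A\<^esub> y), False)] | x y. x \<in> carrier A \<and> y \<in> carrier A}"

text \<open>
  \<open>A *\<^sub>C B\<close>, where the group with carrier \<open>C\<close> is embedded in \<open>A\<close> by \<open>f\<close> and in \<open>B\<close> by \<open>g\<close>:
  the presentation \<open>\<langle>A, B | f(c) = g(c) for c in C\<rangle>\<close>.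
\<close>

definition amalg_gens :: "('a, 'm) monoid_scheme \<Rightarrow> ('b, 'n) monoid_scheme \<Rightarrow> ('a + 'b) set" where
  "amalg_gens A B = carrier A <+> carrier B"

definition amalg_rels ::
    "('a, 'm) monoid_scheme \<Rightarrow> ('b, 'n) monoid_scheme \<Rightarrow> 'c set \<Rightarrow> ('c \<Rightarrow> 'a) \<Rightarrow> ('c \<Rightarrow> 'b) \<Rightarrow>
      ('a + 'b) word set" where
  "amalg_rels A B C f g =
     mult_table Inl A \<union> mult_table Inr B \<union> {[(Inl (f c), True), (Inr (g c), False)] | c. c \<in> C}"

text \<open>
  The HNN extension \<open>A*\<^sub>C\<close> with associated subgroups \<open>C\<close> and \<open>\<theta>(C)\<close> of \<open>A\<close>: the presentation
  \<open>\<langle>A, t | t c t\<inverse> = \<theta>(c) for c in C\<rangle>\<close>. The stable letter \<open>t\<close> is \<^const>\<open>None\<close>.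
\<close>

definition hnn_gens :: "('a, 'm) monoid_scheme \<Rightarrow> 'a option set" where
  "hnn_gens A = insert None (Some ` carrier A)"

definition hnn_rels :: "('a, 'm) monoid_scheme \<Rightarrow> 'a set \<Rightarrow> ('a \<Rightarrow> 'a) \<Rightarrow> 'a option word set" where
  "hnn_rels A C \<theta> =
     mult_table Some A \<union>
     {[(None, True), (Some c, True), (None, False), (Some (\<theta> c), False)] | c. c \<in> C}"

text \<open>
  For subgroups of \<open>G\<close>, the equation \<open>G = A *\<^sub>C B\<close> means that the homomorphism from the
  amalgamated product to \<open>G\<close> that restricts to the inclusions of \<open>A\<close> and \<open>B\<close> is an isomorphism.
  Likewise \<open>G = A*\<^sub>C\<close> means that, for some choice of an embedding \<open>\<theta>\<close> of \<open>C\<close> in \<open>A\<close> and of the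
  image of the stable letter, the inclusion of \<open>A\<close> extends to an isomorphism from the HNN
  extension to \<open>G\<close>.
\<close>

definition is_amalgamated_product ::
    "('a, 'm) monoid_scheme \<Rightarrow> 'a set \<Rightarrow> 'a set \<Rightarrow> 'a set \<Rightarrow> bool" where
  "is_amalgamated_product G A B C \<longleftrightarrow>
     subgroup A G \<and> subgroup B G \<and> subgroup C G \<and> C \<subseteq> A \<and> C \<subseteq> B \<and>
     (let S = amalg_gens (G\<lparr>carrier := A\<rparr>) (G\<lparr>carrier := B\<rparr>);
          R = amalg_rels (G\<lparr>carrier := A\<rparr>) (G\<lparr>carrier := B\<rparr>) C (\<lambda>c. c) (\<lambda>c. c)
      in \<exists>\<phi> \<in> iso (presented_group S R) G.
           (\<forall>a\<in>A. \<phi> (pres_gen S R (Inl a)) = a) \<and> (\<forall>b\<in>B. \<phi> (pres_gen S R (Inr b)) = b))"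

definition is_hnn_extension :: "('a, 'm) monoid_scheme \<Rightarrow> 'a set \<Rightarrow> 'a set \<Rightarrow> bool" where
  "is_hnn_extension G A C \<longleftrightarrow>
     subgroup A G \<and> subgroup C G \<and> C \<subseteq> A \<and>
     (\<exists>\<theta> \<in> mon (G\<lparr>carrier := C\<rparr>) (G\<lparr>carrier := A\<rparr>).
        let S = hnn_gens (G\<lparr>carrier := A\<rparr>); R = hnn_rels (G\<lparr>carrier := A\<rparr>) C \<theta>
        in \<exists>\<phi> \<in> iso (presented_group S R) G. \<forall>a\<in>A. \<phi> (pres_gen S R (Some a)) = a)"

definition splits_over_abelian :: "('a, 'm) monoid_scheme \<Rightarrow> bool" where
  "splits_over_abelian G \<longleftrightarrow>
     (\<exists>C. subgroup C G \<and> comm_group (G\<lparr>carrier := C\<rparr>) \<and>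
        ((\<exists>A B. is_amalgamated_product G A B C \<and> C \<noteq> A \<and> C \<noteq> B) \<or>
         (\<exists>A. is_hnn_extension G A C)))"


section \<open>Right-angled Artin groups and graphs\<close>

text \<open>
  Finite simplicial graphs are modelled by the locale \<^locale>\<open>graph\<close>: finite symmetric digraphs
  without loops and multiple arcs, so an edge is a pair of opposite arcs.
\<close>

definition raag :: "('v, 'e) pre_digraph \<Rightarrow> 'v word set monoid" where
  "raag \<Gamma> = presented_group (verts \<Gamma>)
     {[(u, True), (v, True), (u, False), (v, False)] | u v. u \<rightarrow>\<^bsub>\<Gamma>\<^esub> v}"

definition complete_graph :: "('v, 'e) pre_digraph \<Rightarrow> bool" where
  "complete_graph \<Gamma> \<longleftrightarrow> (\<exists>n. complete_digraph n \<Gamma>)"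

text \<open>
  The library's \<^const>\<open>Digraph_Component.connected\<close> is false for the null graph, which is not
  disconnected either: a disconnected graph is a disjoint union of two nonempty subgraphs.
\<close>

definition disconnected :: "('v, 'e) pre_digraph \<Rightarrow> bool" where
  "disconnected \<Gamma> \<longleftrightarrow> verts \<Gamma> \<noteq> {} \<and> \<not> Digraph_Component.connected \<Gamma>"

lemma (in sym_digraph) disconnected_iff:
  "disconnected G \<longleftrightarrow>
     (\<exists>S T. S \<noteq> {} \<and> T \<noteq> {} \<and> S \<inter> T = {} \<and> S \<union> T = verts G \<and> (\<forall>u\<in>S. \<forall>v\<in>T. \<not> u \<rightarrow>\<^bsub>G\<^esub> v))"
proof
  assume d: "disconnected G"
  have "\<not> strongly_connected G"
  proof
    assume "strongly_connected G"
    then have "verts G \<noteq> {}" and r: "\<And>u v. u \<in> verts G \<Longrightarrow> v \<in> verts G \<Longrightarrow> u \<rightarrow>\<^sup>* v"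
      by (auto simp: strongly_connected_def)
    then have "Digraph_Component.connected G"
      unfolding connected_def strongly_connected_def
      using reachable_mk_symmetric_eq[OF sym_arcs] by (auto simp: mk_symmetric_def)
    with d show False by (simp add: disconnected_def)
  qed
  with d obtain u v where uv: "u \<in> verts G" "v \<in> verts G" "\<not> u \<rightarrow>\<^sup>* v"
    by (auto simp: disconnected_def strongly_connected_def)
  let ?S = "{w \<in> verts G. u \<rightarrow>\<^sup>* w}"
  show "\<exists>S T. S \<noteq> {} \<and> T \<noteq> {} \<and> S \<inter> T = {} \<and> S \<union> T = verts G \<and> (\<forall>u\<in>S. \<forall>v\<in>T. \<not> u \<rightarrow>\<^bsub>G\<^esub> v)"
    using uv by (intro exI[of _ ?S] exI[of _ "verts G - ?S"]) (auto dest: reachable_adj_trans)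
next
  assume "\<exists>S T. S \<noteq> {} \<and> T \<noteq> {} \<and> S \<inter> T = {} \<and> S \<union> T = verts G \<and> (\<forall>u\<in>S. \<forall>v\<in>T. \<not> u \<rightarrow>\<^bsub>G\<^esub> v)"
  then obtain S T a b where ST: "a \<in> S" "b \<in> T" "S \<inter> T = {}" "S \<union> T = verts G"
    and no: "\<And>u v. u \<in> S \<Longrightarrow> v \<in> T \<Longrightarrow> \<not> u \<rightarrow>\<^bsub>G\<^esub> v" by blast
  have "\<not> Digraph_Component.connected G"
  proof
    assume "Digraph_Component.connected G"
    then have "strongly_connected G"
      using symmetric_connected_imp_strongly_connected sym_arcs by blast
    moreover have "a \<in> verts G" "b \<in> verts G" using ST by blast+
    ultimately have "a \<rightarrow>\<^sup>* b" by (simp add: strongly_connected_def)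
    then have "b \<in> S"
    proof (induction rule: reachable_induct)
      case base
      show ?case by (rule ST)
    next
      case (step x y)
      then have "y \<in> verts G" using adj_in_verts by blast
      with step no[of x y] ST show ?case by blast
    qed
    with ST show False by blast
  qed
  with ST show "disconnected G" by (auto simp: disconnected_def)
qed

definition is_clique :: "('v, 'e) pre_digraph \<Rightarrow> 'v set \<Rightarrow> bool" where
  "is_clique \<Gamma> K \<longleftrightarrow> K \<noteq> {} \<and> K \<subseteq> verts \<Gamma> \<and> complete_graph (\<Gamma> \<restriction> K)"

definition separating_clique :: "('v, 'e) pre_digraph \<Rightarrow> 'v set \<Rightarrow> bool" where
  "separating_clique \<Gamma> K \<longleftrightarrow> is_clique \<Gamma> K \<and> disconnected (\<Gamma> \<restriction> (verts \<Gamma> - K))"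

end

theory Submission
  imports Defs "HOL-Algebra.Left_Coset" "HOL-Algebra.Generated_Groups"
begin

text \<open>
  A splitting over an abelian group gives an action on a tree with abelian edge stabilizers and
  without a global fixed vertex, and the converse direction writes down splittings.

  The tree is built without normal forms (\<open>derivation_of_presentation\<close> and
  \<open>amalgamated_product_acts_on_tree\<close>). Its edges are the cosets of the edge group, and a vertex is
  the finite set of edges that separate it from a base vertex. How these sets transform under the
  group is governed by a derivation \<open>D\<close> with values in sets of edges, where \<open>D g\<close> consists of the edges
  between the base vertex and its image under \<open>g\<close>. Such a derivation is a homomorphism to a
  semidirect product, so it can be prescribed on generators by the universal property of the
  presentation. That the graph is a tree is then built in: an edge, by definition, separates exactly
  those vertices of which one contains it and the other does not.

  Suppose that the graph is not complete and that no clique, not even the empty one, separates it. If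
  a generator \<open>v\<close> has no fixed vertex, then it has an axis. The generators that commute with it act on the
  axis, and modulo powers of \<open>v\<close> some power of each of them fixes an edge. Edge stabilizers being
  abelian, these powers commute; in a right-angled Artin group this makes the generators adjacent
  (\<open>powers_not_commute\<close>). Thus the neighbours of \<open>v\<close> form a clique that cuts off \<open>v\<close>, which is
  impossible. So every generator has a fixed vertex, and commuting generators have a common one. The
  generators that fix an edge \<open>e\<close> form a clique, and each of the others has its fixed vertices on one
  side of \<open>e\<close>, with adjacent generators on the same side. As there is no cut, all of them lie on
  the same side, for every \<open>e\<close>. Following the edges in these directions leads to a global fixed vertex
  (\<open>global_fixed_vertex\<close>).

  Conversely, a separating clique \<open>K\<close>, possibly empty, decomposes the group as an amalgam over the free
  abelian group on \<open>K\<close>, which is a proper subgroup of both factors (\<open>clique_cut_splitting\<close>). For a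
  complete graph the group is free abelian and an HNN extension with trivial action of the stable letter
  (\<open>complete_graph_splitting\<close>).
\<close>

section \<open>Evaluating words, and the universal property of a presentation\<close>

definition letter_val :: "('g, 'm) monoid_scheme \<Rightarrow> ('x \<Rightarrow> 'g) \<Rightarrow> 'x \<times> bool \<Rightarrow> 'g" where
  "letter_val G s l = (if snd l then s (fst l) else inv\<^bsub>G\<^esub> s (fst l))"

primrec word_val :: "('g, 'm) monoid_scheme \<Rightarrow> ('x \<Rightarrow> 'g) \<Rightarrow> 'x word \<Rightarrow> 'g" where
  "word_val G s [] = \<one>\<^bsub>G\<^esub>"
| "word_val G s (l # w) = letter_val G s l \<otimes>\<^bsub>G\<^esub> word_val G s w"

context group
begin

lemma letter_val_closed: "s \<in> S \<rightarrow> carrier G \<Longrightarrow> fst l \<in> S \<Longrightarrow> letter_val G s l \<in> carrier G"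
  unfolding letter_val_def Pi_iff by simp

lemma word_val_closed: "s \<in> S \<rightarrow> carrier G \<Longrightarrow> w \<in> words S \<Longrightarrow> word_val G s w \<in> carrier G"
proof (induction w)
  case (Cons l w)
  then have "fst l \<in> S" "w \<in> words S" by (cases l; simp)+
  then show ?case using Cons letter_val_closed[OF Cons.prems(1)] by simp
qed simp

lemma word_val_append:
  assumes s: "s \<in> S \<rightarrow> carrier G" and v: "v \<in> words S"
  shows "u \<in> words S \<Longrightarrow> word_val G s (u @ v) = word_val G s u \<otimes> word_val G s v"
proof (induction u)
  case Nil
  then show ?case using word_val_closed[OF s v] by simp
next
  case (Cons l u)
  then have "fst l \<in> S" "u \<in> words S" by (cases l; simp)+
  then show ?case
    using Cons.IH word_val_closed[OF s] letter_val_closed[OF s] v by (simp add: m_assoc)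
qed

lemma word_val_pres_rel:
  assumes s: "s \<in> S \<rightarrow> carrier G"
    and rel: "\<And>r. r \<in> R \<inter> words S \<Longrightarrow> word_val G s r = \<one>"
    and uv: "(u, v) \<in> pres_rel S R"
  shows "word_val G s u = word_val G s v"
proof -
  have step: "word_val G s u = word_val G s v" if "(u, v) \<in> pres_step S R" for u v
  proof -
    from that obtain a r b where uv: "u = a @ b" "v = a @ r @ b" "a \<in> words S" "b \<in> words S"
      and r: "r \<in> R \<inter> words S \<or> (\<exists>x\<in>S. \<exists>b. r = [(x, b), (x, \<not> b)])"
      unfolding pres_step_def by blast
    have "r \<in> words S" using r by auto
    moreover have "word_val G s r = \<one>"
      using r
    proof
      assume "\<exists>x\<in>S. \<exists>b. r = [(x, b), (x, \<not> b)]"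
      then obtain x b where "x \<in> S" "r = [(x, b), (x, \<not> b)]" by blast
      moreover have "s x \<in> carrier G" using s \<open>x \<in> S\<close> by (simp add: Pi_iff)
      ultimately show ?thesis by (cases b) (simp_all add: letter_val_def)
    qed (rule rel)
    ultimately show ?thesis
      using uv word_val_append[OF s] word_val_closed[OF s] by simp
  qed
  have "(u, v) \<in> (pres_step S R \<union> (pres_step S R)\<inverse>)\<^sup>*" using uv by (simp add: pres_rel_def)
  then show ?thesis by induction (auto dest: step)
qed

lemma word_val_in_subgroup:
  assumes "subgroup H G" "\<And>x. x \<in> S \<Longrightarrow> s x \<in> H"
  shows "w \<in> words S \<Longrightarrow> word_val G s w \<in> H"
  using assms by (induction w) (auto simp: letter_val_def subgroup.m_closed subgroup.m_inv_closed subgroup.one_closed)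

lemma word_val_mult_table:
  assumes A: "group A" and s: "(\<lambda>x. s (\<iota> x)) \<in> hom A G" and r: "r \<in> mult_table \<iota> A"
  shows "word_val G s r = \<one>"
proof -
  interpret A: group A by (rule A)
  obtain x y where xy: "x \<in> carrier A" "y \<in> carrier A"
    and r: "r = [(\<iota> x, True), (\<iota> y, True), (\<iota> (x \<otimes>\<^bsub>A\<^esub> y), False)]"
    using r by (auto simp: mult_table_def)
  have "s (\<iota> x) \<in> carrier G" "s (\<iota> y) \<in> carrier G" using s xy by (auto simp: hom_def)
  then show ?thesis
    unfolding r using hom_mult[OF s xy]
    by (simp add: letter_val_def inv_mult_group m_assoc[symmetric])
qed

lemma subgroup_centralizer:
  assumes "A \<subseteq> carrier G"
  shows "subgroup {z \<in> carrier G. \<forall>g\<in>A. z \<otimes> g = g \<otimes> z} G"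
proof (rule subgroupI)
  show "{z \<in> carrier G. \<forall>g\<in>A. z \<otimes> g = g \<otimes> z} \<noteq> {}"
    using assms by (auto intro!: exI[of _ \<one>])
next
  fix a assume a: "a \<in> {z \<in> carrier G. \<forall>g\<in>A. z \<otimes> g = g \<otimes> z}"
  have "inv a \<otimes> g = g \<otimes> inv a" if "g \<in> A" for g
  proof -
    have g: "g \<in> carrier G" "a \<otimes> g = g \<otimes> a" "a \<in> carrier G" using that assms a by auto
    have "a \<otimes> (g \<otimes> inv a) = (g \<otimes> a) \<otimes> inv a" using g by (metis inv_closed m_assoc)
    also have "\<dots> = g" using g by (simp add: m_assoc)
    finally have "inv a \<otimes> g = inv a \<otimes> (a \<otimes> (g \<otimes> inv a))" by simp
    also have "\<dots> = g \<otimes> inv a"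
    proof -
      have "inv a \<otimes> (a \<otimes> x) = x" if "x \<in> carrier G" for x
        using g(3) that by (simp add: m_assoc[symmetric])
      then show ?thesis using g by simp
    qed
    finally show ?thesis .
  qed
  then show "inv a \<in> {z \<in> carrier G. \<forall>g\<in>A. z \<otimes> g = g \<otimes> z}" using a by simp
next
  fix a b assume a: "a \<in> {z \<in> carrier G. \<forall>g\<in>A. z \<otimes> g = g \<otimes> z}"
    and b: "b \<in> {z \<in> carrier G. \<forall>g\<in>A. z \<otimes> g = g \<otimes> z}"
  have "a \<otimes> b \<otimes> g = g \<otimes> (a \<otimes> b)" if "g \<in> A" for g
  proof -
    have g: "g \<in> carrier G" "a \<otimes> g = g \<otimes> a" "b \<otimes> g = g \<otimes> b" "a \<in> carrier G" "b \<in> carrier G"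
      using that assms a b by auto
    then show ?thesis by (metis m_assoc)
  qed
  then show "a \<otimes> b \<in> {z \<in> carrier G. \<forall>g\<in>A. z \<otimes> g = g \<otimes> z}" using a b by simp
qed auto

lemma hom_word_val:
  assumes H: "group H" and f: "f \<in> hom G H" and s: "s \<in> S \<rightarrow> carrier G"
  shows "w \<in> words S \<Longrightarrow> f (word_val G s w) = word_val H (\<lambda>x. f (s x)) w"
proof (induction w)
  case Nil
  show ?case using hom_one[OF f is_group H] by simp
next
  case (Cons l w)
  interpret h: group_hom G H f using H f by (simp add: group_hom_def group_hom_axioms_def is_group)
  have "fst l \<in> S" "w \<in> words S" using Cons.prems by (cases l; simp)+
  moreover have "f (letter_val G s l) = letter_val H (\<lambda>x. f (s x)) l"
    using s \<open>fst l \<in> S\<close> by (simp add: letter_val_def Pi_iff)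
  ultimately show ?case
    using Cons.IH word_val_closed[OF s] letter_val_closed[OF s] by simp
qed

end

lemma pres_gen_closed: "x \<in> S \<Longrightarrow> pres_gen S R x \<in> carrier (presented_group S R)"
  by (auto simp: pres_gen_def presented_group_def intro!: quotientI)

lemma inv_pres_gen:
  assumes "x \<in> S"
  shows "inv\<^bsub>presented_group S R\<^esub> pres_gen S R x = pres_rel S R `` {[(x, False)]}"
proof -
  interpret group "presented_group S R" by (rule group_presented_group)
  have rel: "([(x, False), (x, True)], []) \<in> pres_rel S R"
    using pres_rel_word_inv[of "[(x, True)]" S R] assms by (simp add: word_inv_def)
  then have "pres_rel S R `` {[(x, False)]} \<otimes>\<^bsub>presented_group S R\<^esub> pres_gen S R x = \<one>\<^bsub>presented_group S R\<^esub>"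
    using assms equiv_class_eq[OF equiv_pres_rel rel]
    unfolding pres_gen_def by (subst presented_group_mult) (simp_all add: presented_group_def)
  moreover have "pres_rel S R `` {[(x, False)]} \<in> carrier (presented_group S R)"
    using assms by (auto simp: presented_group_def intro!: quotientI)
  ultimately show ?thesis using inv_equality pres_gen_closed[OF assms] by blast
qed

lemma word_val_pres_gen:
  "w \<in> words S \<Longrightarrow> word_val (presented_group S R) (pres_gen S R) w = pres_rel S R `` {w}"
proof (induction w)
  case Nil
  then show ?case by (simp add: presented_group_def)
next
  case (Cons l w)
  obtain x b where l: "l = (x, b)" by (cases l)
  have "letter_val (presented_group S R) (pres_gen S R) l = pres_rel S R `` {[l]}"
    using Cons.prems l inv_pres_gen[of x S R] by (auto simp: letter_val_def pres_gen_def)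
  then show ?case
    using Cons l presented_group_mult[of "[l]" S w R] by simp
qed

lemma presented_group_surj:
  "X \<in> carrier (presented_group S R) \<Longrightarrow>
    \<exists>w\<in>words S. X = word_val (presented_group S R) (pres_gen S R) w"
  by (auto simp: presented_group_def word_val_pres_gen[unfolded presented_group_def] elim!: quotientE)

text \<open>
  The homomorphism evaluates a chosen representative of each class; since the relators have trivial
  value, the choice does not matter.
\<close>
theorem (in group) presented_group_lift:
  assumes s: "s \<in> S \<rightarrow> carrier G"
    and rel: "\<And>r. r \<in> R \<inter> words S \<Longrightarrow> word_val G s r = \<one>"
  obtains \<psi> where "\<psi> \<in> hom (presented_group S R) G" "\<And>x. x \<in> S \<Longrightarrow> \<psi> (pres_gen S R x) = s x"
proof -
  define \<psi> where "\<psi> X = word_val G s (SOME w. w \<in> X)" for X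
  have \<psi>: "\<psi> (pres_rel S R `` {w}) = word_val G s w" if "w \<in> words S" for w
  proof -
    have "w \<in> pres_rel S R `` {w}" using that by (auto simp: pres_rel_def)
    then have "(SOME v. v \<in> pres_rel S R `` {w}) \<in> pres_rel S R `` {w}" by (rule someI)
    then have "(w, SOME v. v \<in> pres_rel S R `` {w}) \<in> pres_rel S R" by blast
    then show ?thesis unfolding \<psi>_def using word_val_pres_rel[OF s rel] by metis
  qed
  have "\<psi> \<in> hom (presented_group S R) G"
  proof (rule homI)
    fix X assume "X \<in> carrier (presented_group S R)"
    then obtain u where u: "u \<in> words S" "X = pres_rel S R `` {u}"
      by (auto simp: presented_group_def elim!: quotientE)
    then show "\<psi> X \<in> carrier G" using \<psi> word_val_closed[OF s] by simp
    fix Y assume "Y \<in> carrier (presented_group S R)"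
    then obtain v where v: "v \<in> words S" "Y = pres_rel S R `` {v}"
      by (auto simp: presented_group_def elim!: quotientE)
    show "\<psi> (X \<otimes>\<^bsub>presented_group S R\<^esub> Y) = \<psi> X \<otimes> \<psi> Y"
      using u v by (simp add: presented_group_mult \<psi> word_val_append[OF s])
  qed
  moreover have "\<psi> (pres_gen S R x) = s x" if "x \<in> S" for x
    using \<psi>[of "[(x, True)]"] that s by (simp add: pres_gen_def letter_val_def Pi_iff)
  ultimately show ?thesis using that by blast
qed

lemma relator_trivial:
  assumes "r \<in> R \<inter> words S"
  shows "word_val (presented_group S R) (pres_gen S R) r = \<one>\<^bsub>presented_group S R\<^esub>"
proof -
  have "([] @ [], [] @ r @ []) \<in> pres_step S R"
    unfolding pres_step_def mem_Collect_eq using assms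
    by (intro exI[of _ "[]"] exI[of _ r]) simp
  then have "([], r) \<in> pres_rel S R" using assms by (auto simp: pres_rel_def)
  then show ?thesis
    using assms word_val_pres_gen[of r S R] equiv_class_eq[OF equiv_pres_rel, of "[]" r S R]
    by (simp add: presented_group_def)
qed

text \<open>
  A group that is isomorphic to a presented group inherits the universal property: maps on the
  generators that respect the relators extend to \<open>G\<close>.
\<close>
lemma iso_presented_lift:
  assumes G: "group G" and \<phi>: "\<phi> \<in> iso (presented_group S R) G" and H: "group H"
    and s: "s \<in> S \<rightarrow> carrier H"
    and rel: "\<And>r. r \<in> R \<inter> words S \<Longrightarrow> word_val H s r = \<one>\<^bsub>H\<^esub>"
  obtains \<Psi> where "\<Psi> \<in> hom G H" "\<And>x. x \<in> S \<Longrightarrow> \<Psi> (\<phi> (pres_gen S R x)) = s x"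
proof -
  interpret P: group "presented_group S R" by (rule group_presented_group)
  obtain \<psi> where \<psi>: "\<psi> \<in> hom (presented_group S R) H" "\<And>x. x \<in> S \<Longrightarrow> \<psi> (pres_gen S R x) = s x"
    using group.presented_group_lift[OF H s rel] by blast
  let ?i = "inv_into (carrier (presented_group S R)) \<phi>"
  have "?i \<in> hom G (presented_group S R)"
    using P.iso_set_sym[OF \<phi>] by (simp add: iso_def)
  then have "\<psi> \<circ> ?i \<in> hom G H" using \<psi>(1) by (rule hom_compose)
  moreover have "?i (\<phi> (pres_gen S R x)) = pres_gen S R x" if "x \<in> S" for x
    using \<phi> pres_gen_closed[OF that] by (auto simp: iso_def bij_betw_def)
  ultimately show ?thesis using \<psi>(2) that by auto
qed

lemma iso_presented_surj:
  assumes G: "group G" and \<phi>: "\<phi> \<in> iso (presented_group S R) G" and g: "g \<in> carrier G"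
  shows "\<exists>w\<in>words S. g = word_val G (\<lambda>x. \<phi> (pres_gen S R x)) w"
proof -
  interpret P: group "presented_group S R" by (rule group_presented_group)
  obtain X where "X \<in> carrier (presented_group S R)" "g = \<phi> X"
    using \<phi> g by (auto simp: iso_def bij_betw_def)
  moreover obtain w where w: "w \<in> words S" "X = word_val (presented_group S R) (pres_gen S R) w"
    using presented_group_surj \<open>X \<in> _\<close> by blast
  moreover have "\<phi> \<in> hom (presented_group S R) G" using \<phi> by (simp add: iso_def)
  then have "\<phi> X = word_val G (\<lambda>x. \<phi> (pres_gen S R x)) w"
    unfolding w(2) by (rule P.hom_word_val[OF G _ _ w(1)]) (simp add: Pi_iff pres_gen_closed)
  ultimately show ?thesis by auto
qed

lemma iso_presented_generates:
  assumes G: "group G" and \<phi>: "\<phi> \<in> iso (presented_group S R) G" and H: "subgroup H G"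
    and gens: "\<And>x. x \<in> S \<Longrightarrow> \<phi> (pres_gen S R x) \<in> H"
  shows "carrier G \<subseteq> H"
proof
  fix g assume "g \<in> carrier G"
  then obtain w where w: "w \<in> words S" "g = word_val G (\<lambda>x. \<phi> (pres_gen S R x)) w"
    using iso_presented_surj[OF G \<phi>] by blast
  show "g \<in> H" unfolding w(2) by (rule group.word_val_in_subgroup[OF G H gens w(1)])
qed

section \<open>Derivations of groups that act on sets\<close>

text \<open>
  In a tree with edge set \<open>E\<close>, a vertex is determined by the set of edges that separate it from a
  base vertex. Vertices are therefore encoded as sets of edges, and the edges on the geodesic from
  \<open>p\<close> to \<open>q\<close> form the symmetric difference of \<open>p\<close> and \<open>q\<close>. This is addition in the vector space of
  subsets of \<open>E\<close> over the field with two elements.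
\<close>
definition sep :: "'e set \<Rightarrow> 'e set \<Rightarrow> 'e set" where
  "sep p q = (p - q) \<union> (q - p)"

lemma mem_sep: "e \<in> sep p q \<longleftrightarrow> (e \<in> p) \<noteq> (e \<in> q)"
  by (auto simp: sep_def)

lemma sep_commute: "sep p q = sep q p"
  by (auto simp: mem_sep)

lemma sep_eq_empty [simp]: "sep p q = {} \<longleftrightarrow> p = q"
  by (auto simp: sep_def)

lemma sep_self [simp]: "sep p p = {}"
  by simp

lemma sep_empty [simp]: "sep p {} = p" "sep {} p = p"
  by (auto simp: sep_def)

lemma sep_assoc: "sep (sep p q) r = sep p (sep q r)"
  by (auto simp: mem_sep)

locale set_action = group G for G :: "('g, 'm) monoid_scheme" (structure) +
  fixes E :: "'e set" and act :: "'g \<Rightarrow> 'e \<Rightarrow> 'e"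
  assumes act_closed: "g \<in> carrier G \<Longrightarrow> e \<in> E \<Longrightarrow> act g e \<in> E"
    and act_one: "e \<in> E \<Longrightarrow> act \<one> e = e"
    and act_mult: "g \<in> carrier G \<Longrightarrow> h \<in> carrier G \<Longrightarrow> e \<in> E \<Longrightarrow> act (g \<otimes> h) e = act g (act h e)"
begin

lemma act_inv: "g \<in> carrier G \<Longrightarrow> e \<in> E \<Longrightarrow> act (inv g) (act g e) = e"
  using act_mult[of "inv g" g e] act_one by simp

lemma act_inv': "g \<in> carrier G \<Longrightarrow> e \<in> E \<Longrightarrow> act g (act (inv g) e) = e"
  using act_mult[of g "inv g" e] act_one by simp

lemma act_eq_iff: "g \<in> carrier G \<Longrightarrow> e \<in> E \<Longrightarrow> f \<in> E \<Longrightarrow> act g e = act g f \<longleftrightarrow> e = f"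
  by (metis act_inv)

lemma image_sep:
  assumes "g \<in> carrier G" "p \<subseteq> E" "q \<subseteq> E"
  shows "act g ` sep p q = sep (act g ` p) (act g ` q)"
proof -
  have "inj_on (act g) E" using act_eq_iff[OF assms(1)] by (auto intro!: inj_onI)
  then have "act g ` (p - q) = act g ` p - act g ` q" "act g ` (q - p) = act g ` q - act g ` p"
    using inj_on_image_set_diff[of "act g" E p q] inj_on_image_set_diff[of "act g" E q p] assms by blast+
  then show ?thesis by (simp add: sep_def image_Un)
qed

text \<open>
  Homomorphisms \<open>g \<mapsto> (D g, g)\<close> into the semidirect product of the subsets of \<open>E\<close> with \<open>G\<close> correspond
  to derivations \<open>D\<close>, that is, to maps with \<open>D (g h) = D g + g D h\<close>.
\<close>
definition semidirect :: "('e set \<times> 'g) monoid" where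
  "semidirect = \<lparr>carrier = Pow E \<times> carrier G,
     monoid.mult = (\<lambda>(p, g) (q, h). (sep p (act g ` q), g \<otimes> h)), one = ({}, \<one>)\<rparr>"

lemma group_semidirect: "group semidirect"
proof (rule groupI)
  have image_closed: "act g ` p \<subseteq> E" if "g \<in> carrier G" "p \<subseteq> E" for g p
    using act_closed[OF that(1)] that(2) by blast
  have sep_closed: "sep p q \<subseteq> E" if "p \<subseteq> E" "q \<subseteq> E" for p q
    using that unfolding sep_def by blast
  show "\<one>\<^bsub>semidirect\<^esub> \<in> carrier semidirect" by (simp add: semidirect_def)
  fix x assume x: "x \<in> carrier semidirect"
  obtain p g where pg: "x = (p, g)" "p \<subseteq> E" "g \<in> carrier G" using x by (auto simp: semidirect_def)
  have "act \<one> ` p = p" using pg(2) act_one by force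
  then show "\<one>\<^bsub>semidirect\<^esub> \<otimes>\<^bsub>semidirect\<^esub> x = x" using pg by (simp add: semidirect_def)
  have "act (inv g) ` act g ` p = p" unfolding image_image using pg(2) act_inv[OF pg(3)] by force
  moreover have "act (inv g) ` p \<subseteq> E" by (rule image_closed) (use pg in auto)
  ultimately show "\<exists>y\<in>carrier semidirect. y \<otimes>\<^bsub>semidirect\<^esub> x = \<one>\<^bsub>semidirect\<^esub>"
    using pg by (intro bexI[of _ "(act (inv g) ` p, inv g)"]) (auto simp: semidirect_def)
  fix y assume y: "y \<in> carrier semidirect"
  obtain q h where qh: "y = (q, h)" "q \<subseteq> E" "h \<in> carrier G" using y by (auto simp: semidirect_def)
  show "x \<otimes>\<^bsub>semidirect\<^esub> y \<in> carrier semidirect"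
    using pg qh sep_closed image_closed by (simp add: semidirect_def)
  fix z assume z: "z \<in> carrier semidirect"
  obtain r k where rk: "z = (r, k)" "r \<subseteq> E" "k \<in> carrier G" using z by (auto simp: semidirect_def)
  have "act (g \<otimes> h) ` r = act g ` act h ` r"
    unfolding image_image using pg qh rk act_mult by (intro image_cong) auto
  moreover have "act g ` sep q (act h ` r) = sep (act g ` q) (act g ` act h ` r)"
    using pg qh rk image_closed by (intro image_sep) auto
  ultimately show "x \<otimes>\<^bsub>semidirect\<^esub> y \<otimes>\<^bsub>semidirect\<^esub> z = x \<otimes>\<^bsub>semidirect\<^esub> (y \<otimes>\<^bsub>semidirect\<^esub> z)"
    using pg qh rk by (simp add: semidirect_def m_assoc sep_assoc)
qed

text \<open>
  Derivations can be prescribed on generators as long as the relators are respected: this is the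
  universal property of the presentation applied to the semidirect product. The second component of
  the resulting homomorphism is the identity because it is so on generators.
\<close>
lemma derivation_of_presentation:
  assumes \<phi>: "\<phi> \<in> iso (presented_group S R) G"
    and d: "\<And>x. x \<in> S \<Longrightarrow> d x \<subseteq> E"
    and rel: "\<And>r. r \<in> R \<inter> words S \<Longrightarrow>
      word_val semidirect (\<lambda>x. (d x, \<phi> (pres_gen S R x))) r = \<one>\<^bsub>semidirect\<^esub>"
  obtains D where "\<And>g. g \<in> carrier G \<Longrightarrow> D g \<subseteq> E"
    "\<And>g h. g \<in> carrier G \<Longrightarrow> h \<in> carrier G \<Longrightarrow> D (g \<otimes> h) = sep (D g) (act g ` D h)"
    "\<And>x. x \<in> S \<Longrightarrow> D (\<phi> (pres_gen S R x)) = d x"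
proof -
  let ?s = "\<lambda>x. (d x, \<phi> (pres_gen S R x))"
  have \<phi>x: "\<phi> (pres_gen S R x) \<in> carrier G" if "x \<in> S" for x
    using \<phi> pres_gen_closed[OF that] by (auto simp: iso_def hom_def)
  then have "?s \<in> S \<rightarrow> carrier semidirect" using d by (auto simp: semidirect_def)
  then obtain \<Psi> where hom: "\<Psi> \<in> hom G semidirect" and \<Psi>: "\<And>x. x \<in> S \<Longrightarrow> \<Psi> (\<phi> (pres_gen S R x)) = ?s x"
    using iso_presented_lift[OF is_group \<phi> group_semidirect _ rel] by blast
  interpret \<Psi>: group_hom G semidirect \<Psi>
    using hom group_semidirect by (simp add: group_hom_def group_hom_axioms_def is_group)
  have mult: "\<Psi> (g \<otimes> h) = (sep (fst (\<Psi> g)) (act (snd (\<Psi> g)) ` fst (\<Psi> h)), snd (\<Psi> g) \<otimes> snd (\<Psi> h))"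
    if "g \<in> carrier G" "h \<in> carrier G" for g h
    using hom_mult[OF hom that] by (simp add: semidirect_def case_prod_unfold)
  have closed: "fst (\<Psi> g) \<subseteq> E" "snd (\<Psi> g) \<in> carrier G" if "g \<in> carrier G" for g
    using \<Psi>.hom_closed[OF that] by (auto simp: semidirect_def)
  have "subgroup {g \<in> carrier G. snd (\<Psi> g) = g} G"
  proof (rule subgroupI)
    have "snd (\<Psi> \<one>) = \<one>" using \<Psi>.hom_one by (simp add: semidirect_def)
    then show "{g \<in> carrier G. snd (\<Psi> g) = g} \<noteq> {}" by blast
  next
    fix a assume a: "a \<in> {g \<in> carrier G. snd (\<Psi> g) = g}"
    then have "snd (\<Psi> (inv a)) \<otimes> a = \<one>"
      using mult[of "inv a" a] \<Psi>.hom_one by (simp add: semidirect_def)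
    then have "snd (\<Psi> (inv a)) = inv a"
      using a closed(2)[of "inv a"] inv_equality[of "snd (\<Psi> (inv a))" a]
      by (simp del: \<Psi>.hom_inv)
    then show "inv a \<in> {g \<in> carrier G. snd (\<Psi> g) = g}" using a by (simp del: \<Psi>.hom_inv)
  qed (auto simp: mult simp del: \<Psi>.hom_mult)
  then have "carrier G \<subseteq> {g \<in> carrier G. snd (\<Psi> g) = g}"
    by (rule iso_presented_generates[OF is_group \<phi>]) (use \<Psi> \<phi>x in auto)
  then have "snd (\<Psi> g) = g" if "g \<in> carrier G" for g using that by blast
  then show ?thesis
    using that[of "\<lambda>g. fst (\<Psi> g)"] closed(1) mult \<Psi> by (simp del: \<Psi>.hom_mult)
qed

end

section \<open>Trees whose vertices are sets of edges\<close>

text \<open>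
  The data of a tree on which \<open>G\<close> acts with one orbit of edges, before connectedness: \<open>D g\<close> is the set
  of edges that separate the base vertex from its image under \<open>g\<close>, and \<open>e0\<close> is an edge at the base
  vertex. The other end of \<open>e0\<close> is then the vertex \<open>{e0}\<close>. The last assumption says that the stabilizer
  of \<open>e0\<close> fixes both ends, so that there are no inversions.
\<close>
locale cut_action = set_action G E act
  for G :: "('g, 'm) monoid_scheme" (structure) and E :: "'e set" and act +
  fixes e0 :: 'e and D :: "'g \<Rightarrow> 'e set"
  assumes e0: "e0 \<in> E"
    and transitive: "e \<in> E \<Longrightarrow> \<exists>g\<in>carrier G. e = act g e0"
    and D_sub: "g \<in> carrier G \<Longrightarrow> D g \<subseteq> E"
    and D_mult: "g \<in> carrier G \<Longrightarrow> h \<in> carrier G \<Longrightarrow> D (g \<otimes> h) = sep (D g) (act g ` D h)"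
    and D_stab: "g \<in> carrier G \<Longrightarrow> act g e0 = e0 \<Longrightarrow> D g = {}"
begin

text \<open>
  The action on vertices: the edges between the base vertex and \<open>g p\<close> are those between the base
  vertex and its image, added to the translates of those between the base vertex and \<open>p\<close>.
\<close>
definition mv :: "'g \<Rightarrow> 'e set \<Rightarrow> 'e set" where
  "mv g p = sep (D g) (act g ` p)"

text \<open>
  There are at most two orbits of vertices, those of the two ends of \<open>e0\<close>.
\<close>
definition V :: "'e set set" where
  "V = {mv g p | g p. g \<in> carrier G \<and> p \<in> {{}, {e0}}}"

definition adj :: "'e \<Rightarrow> 'e set \<Rightarrow> 'e set \<Rightarrow> bool" where
  "adj e p q \<longleftrightarrow> (\<exists>g\<in>carrier G. e = act g e0 \<and>
     (p = mv g {} \<and> q = mv g {e0} \<or> p = mv g {e0} \<and> q = mv g {}))"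

lemma mv_sub: "g \<in> carrier G \<Longrightarrow> p \<subseteq> E \<Longrightarrow> mv g p \<subseteq> E"
  using D_sub[of g] act_closed[of g] unfolding mv_def sep_def by blast

lemma D_one: "D \<one> = {}"
  by (rule D_stab) (auto simp: act_one e0)

lemma mv_one: "p \<subseteq> E \<Longrightarrow> mv \<one> p = p"
  by (auto simp: mv_def D_one act_one subset_iff image_iff)

lemma mv_mult:
  assumes "g \<in> carrier G" "h \<in> carrier G" "p \<subseteq> E"
  shows "mv (g \<otimes> h) p = mv g (mv h p)"
proof -
  have "act h ` p \<subseteq> E" using assms act_closed by auto
  then have "mv g (mv h p) = sep (D g) (sep (act g ` D h) (act g ` act h ` p))"
    unfolding mv_def using assms D_sub by (simp add: image_sep)
  moreover have "act g ` act h ` p = act (g \<otimes> h) ` p"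
    unfolding image_image using assms act_mult by (intro image_cong) auto
  moreover have "sep (D g) (sep (act g ` D h) X) = sep (sep (D g) (act g ` D h)) X" for X
    by (auto simp: mem_sep)
  ultimately show ?thesis using assms by (simp add: mv_def D_mult)
qed

lemma mv_inv: "g \<in> carrier G \<Longrightarrow> p \<subseteq> E \<Longrightarrow> mv (inv g) (mv g p) = p"
  using mv_mult[of "inv g" g p] mv_one by simp

lemma mv_inv': "g \<in> carrier G \<Longrightarrow> p \<subseteq> E \<Longrightarrow> mv g (mv (inv g) p) = p"
  using mv_mult[of g "inv g" p] mv_one by simp

lemma sep_mv:
  assumes "g \<in> carrier G" "p \<subseteq> E" "q \<subseteq> E"
  shows "sep (mv g p) (mv g q) = act g ` sep p q"
proof -
  have "sep (sep (D g) X) (sep (D g) Y) = sep X Y" for X Y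
    by (auto simp: mem_sep)
  then show ?thesis using assms by (simp add: mv_def image_sep)
qed

lemma V_sub: "p \<in> V \<Longrightarrow> p \<subseteq> E"
  using mv_sub[of _ "{e0}"] mv_sub[of _ "{}"] e0 by (fastforce simp: V_def)

lemma sep_sub: "p \<in> V \<Longrightarrow> q \<in> V \<Longrightarrow> sep p q \<subseteq> E"
  using V_sub[of p] V_sub[of q] unfolding sep_def by blast

lemma mv_closed: "g \<in> carrier G \<Longrightarrow> p \<in> V \<Longrightarrow> mv g p \<in> V"
proof -
  assume g: "g \<in> carrier G" and "p \<in> V"
  then obtain h b where "h \<in> carrier G" "b \<in> {{}, {e0}}" "p = mv h b" by (auto simp: V_def)
  moreover have "mv g (mv h b) = mv (g \<otimes> h) b" using calculation e0 g by (subst mv_mult) auto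
  ultimately show ?thesis unfolding V_def using g by blast
qed

lemma sep_mv_V:
  "g \<in> carrier G \<Longrightarrow> p \<in> V \<Longrightarrow> q \<in> V \<Longrightarrow> sep (mv g p) (mv g q) = act g ` sep p q"
  by (simp add: sep_mv V_sub)

lemma mv_inv_V [simp]:
  "g \<in> carrier G \<Longrightarrow> p \<in> V \<Longrightarrow> mv (inv g) (mv g p) = p"
  "g \<in> carrier G \<Longrightarrow> p \<in> V \<Longrightarrow> mv g (mv (inv g) p) = p"
  by (simp_all add: mv_inv mv_inv' V_sub)

lemma mv_mult_V:
  "g \<in> carrier G \<Longrightarrow> h \<in> carrier G \<Longrightarrow> p \<in> V \<Longrightarrow> mv (g \<otimes> h) p = mv g (mv h p)"
  by (simp add: mv_mult V_sub)

lemma mv_one_V: "p \<in> V \<Longrightarrow> mv \<one> p = p"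
  by (simp add: mv_one V_sub)

lemma act_mem_sep_mv:
  assumes "g \<in> carrier G" "p \<in> V" "q \<in> V" "e \<in> E"
  shows "act g e \<in> sep (mv g p) (mv g q) \<longleftrightarrow> e \<in> sep p q"
  using assms sep_sub[of p q] act_eq_iff[OF assms(1,4)] by (auto simp: sep_mv_V)

lemma card_sep_mv:
  assumes "g \<in> carrier G" "p \<in> V" "q \<in> V"
  shows "card (sep (mv g p) (mv g q)) = card (sep p q)"
proof -
  have "inj_on (act g) (sep p q)"
    using act_eq_iff[OF assms(1)] sep_sub[OF assms(2,3)] by (auto intro!: inj_onI)
  then show ?thesis using assms by (simp add: sep_mv_V card_image)
qed

lemma mv_V_base: "g \<in> carrier G \<Longrightarrow> mv g {} \<in> V" "g \<in> carrier G \<Longrightarrow> mv g {e0} \<in> V"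
  by (auto simp: V_def)

lemma adj_sym: "adj e p q \<Longrightarrow> adj e q p"
  by (auto simp: adj_def)

lemma adj_closed: "adj e p q \<Longrightarrow> e \<in> E" "adj e p q \<Longrightarrow> p \<in> V" "adj e p q \<Longrightarrow> q \<in> V"
  by (auto simp: adj_def mv_V_base act_closed e0)

lemma adj_exists: "e \<in> E \<Longrightarrow> \<exists>p q. adj e p q"
  using transitive[of e] by (auto simp: adj_def)

lemma adj_sep: "adj e p q \<Longrightarrow> sep p q = {e}"
  using sep_mv[of _ "{}" "{e0}"] sep_mv[of _ "{e0}" "{}"] e0 by (auto simp: adj_def)

lemma adj_mv:
  assumes g: "g \<in> carrier G" and pq: "adj e p q"
  shows "adj (act g e) (mv g p) (mv g q)"
proof -
  obtain h where h: "h \<in> carrier G" "e = act h e0"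
    "p = mv h {} \<and> q = mv h {e0} \<or> p = mv h {e0} \<and> q = mv h {}"
    using pq by (auto simp: adj_def)
  have "act g e = act (g \<otimes> h) e0" "mv g (mv h {}) = mv (g \<otimes> h) {}"
    "mv g (mv h {e0}) = mv (g \<otimes> h) {e0}"
    using g h e0 by (simp_all add: act_mult mv_mult)
  then show ?thesis unfolding adj_def using g h by (intro bexI[of _ "g \<otimes> h"]) auto
qed

text \<open>
  Each edge is a translate of \<open>e0\<close>, and its two ends do not depend on the translating element. This
  makes the ends of an edge unique (\<open>adj_unique\<close>) and rules out inversions (\<open>adj_fixed\<close>).
\<close>
lemma mv_base_eq:
  assumes g: "g \<in> carrier G" and h: "h \<in> carrier G" and eq: "act g e0 = act h e0"
    and b: "b \<in> {{}, {e0}}"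
  shows "mv g b = mv h b"
proof -
  let ?k = "inv h \<otimes> g"
  have k: "?k \<in> carrier G" "act ?k e0 = e0"
    using g h eq e0 by (simp_all add: act_mult act_inv)
  then have "mv ?k b = b" using b D_stab by (auto simp: mv_def)
  moreover have "g = h \<otimes> ?k" using g h by (simp add: m_assoc[symmetric])
  ultimately show ?thesis using mv_mult[OF h k(1), of b] b e0 by auto
qed

lemma adj_unique:
  assumes "adj e p q" "adj e p' q'"
  shows "p' = p \<and> q' = q \<or> p' = q \<and> q' = p"
  using assms mv_base_eq unfolding adj_def by (metis insertCI)

lemma adj_fixed:
  assumes g: "g \<in> carrier G" "act g e = e" and pq: "adj e p q"
  shows "mv g p = p"
proof -
  obtain h where h: "h \<in> carrier G" "e = act h e0"
    "p = mv h {} \<or> p = mv h {e0}"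
    using pq by (auto simp: adj_def)
  have "act (g \<otimes> h) e0 = act h e0" using g h e0 by (simp add: act_mult)
  then have "mv (g \<otimes> h) b = mv h b" if "b \<in> {{}, {e0}}" for b
    using mv_base_eq[OF _ h(1) _ that, of "g \<otimes> h"] g h by simp
  then have "mv g (mv h b) = mv h b" if "b \<in> {{}, {e0}}" for b
    using that mv_mult[of g h b] g h e0 by auto
  then show ?thesis using h(3) by blast
qed

lemma sep_adj:
  assumes "adj e p p'" "e \<in> sep p q"
  shows "sep p q = insert e (sep p' q)" "e \<notin> sep p' q"
proof -
  have "sep p p' = {e}" using adj_sep assms by blast
  then have *: "x \<in> p \<longleftrightarrow> (x \<in> p') \<noteq> (x = e)" for x using mem_sep[of x p p'] by auto
  show "sep p q = insert e (sep p' q)" "e \<notin> sep p' q"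
    using assms(2) by (auto simp: mem_sep *)
qed

lemma sep_adj':
  assumes "adj e p p'" "x \<noteq> e"
  shows "x \<in> sep p q \<longleftrightarrow> x \<in> sep p' q"
proof -
  have "x \<notin> sep p p'" using adj_sep assms by auto
  then show ?thesis unfolding mem_sep by blast
qed

lemma adj_flip:
  assumes "adj e p p'"
  shows "e \<in> sep p q \<longleftrightarrow> e \<notin> sep p' q"
proof -
  have "e \<in> sep p p'" using adj_sep[OF assms] by simp
  then show ?thesis unfolding mem_sep by blast
qed

text \<open>
  \<open>geo p q\<close> says that some edge path from \<open>p\<close> to \<open>q\<close> crosses no edge twice. Every edge path can be
  shortened to such a path (\<open>geo_step\<close>), because an edge has only one pair of ends: a path that crosses
  an edge a second time has returned to an end that it visited before.
\<close>
inductive geo :: "'e set \<Rightarrow> 'e set \<Rightarrow> bool" where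
  geo_refl: "p \<in> V \<Longrightarrow> geo p p"
| geo_cons: "adj e p p' \<Longrightarrow> geo p' q \<Longrightarrow> e \<notin> sep p' q \<Longrightarrow> geo p q"

text \<open>
  A path that crosses \<open>e\<close> passes through both ends of \<open>e\<close>, first through the one on the side on which
  the path begins.
\<close>
lemma geo_gate:
  "geo a b \<Longrightarrow> e \<in> sep a b \<Longrightarrow> adj e x y \<Longrightarrow> e \<notin> sep a x \<Longrightarrow> sep a x \<subseteq> sep a b \<and> geo y b"
proof (induction rule: geo.induct)
  case (geo_refl p)
  have "sep p p = {}" by simp
  then show ?case using geo_refl.prems(1) by blast
next
  case (geo_cons e1 a a' b)
  have ab: "sep a b = insert e1 (sep a' b)"
    using sep_adj(1)[OF geo_cons.hyps(1)] adj_flip[OF geo_cons.hyps(1)] geo_cons.hyps(3) by blast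
  show ?case
  proof (cases "e = e1")
    case True
    have "a = x \<and> a' = y"
      using adj_unique[OF geo_cons.prems(2), of a a'] geo_cons.hyps(1) True geo_cons.prems(3)
        adj_sep[OF adj_sym[OF geo_cons.prems(2)]] by blast
    then show ?thesis using geo_cons.hyps by simp
  next
    case False
    have "e \<in> sep a' b" using geo_cons.prems(1) False ab by simp
    moreover have "e \<notin> sep a' x" using sep_adj'[OF geo_cons.hyps(1) False] geo_cons.prems(3) by simp
    ultimately have IH: "sep a' x \<subseteq> sep a' b" "geo y b"
      using geo_cons.IH geo_cons.prems(2) by auto
    have "sep a x \<subseteq> insert e1 (sep a' x)" using sep_adj'[OF geo_cons.hyps(1)] by blast
    then show ?thesis using IH ab by auto
  qed
qed

lemma geo_step:
  assumes "adj e p p'" "geo p' q"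
  shows "geo p q"
proof (cases "e \<in> sep p' q")
  case True
  then show ?thesis using geo_gate[OF assms(2) True adj_sym[OF assms(1)]] by simp
next
  case False
  then show ?thesis using assms geo_cons by blast
qed

end

locale tree_action = cut_action G E act e0 D
  for G :: "('g, 'm) monoid_scheme" (structure) and E :: "'e set" and act e0 D +
  assumes connected: "g \<in> carrier G \<Longrightarrow> ({}, D g) \<in> {(p, q). \<exists>e. adj e p q}\<^sup>*"
begin

lemma reach_geo:
  "(p, q) \<in> {(p, q). \<exists>e. adj e p q}\<^sup>* \<Longrightarrow> q \<in> V \<Longrightarrow> geo p q"
  by (induction rule: converse_rtrancl_induct) (auto intro: geo_refl geo_step)

lemma V_connected:
  assumes "p \<in> V" "q \<in> V"
  shows "geo p q"
proof -
  let ?T = "{(p, q). \<exists>e. adj e p q}"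
  have sym: "(y, x) \<in> ?T\<^sup>*" if "(x, y) \<in> ?T\<^sup>*" for x y
  proof -
    have "sym ?T" by (auto simp: sym_def intro: adj_sym)
    then show ?thesis using that by (meson symE sym_rtrancl)
  qed
  have base: "({}, x) \<in> ?T\<^sup>*" if x: "x \<in> V" for x
  proof -
    obtain g b where g: "g \<in> carrier G" "b \<in> {{}, {e0}}" "x = mv g b" using x by (auto simp: V_def)
    have "({}, mv g {}) \<in> ?T\<^sup>*" using connected[OF g(1)] by (simp add: mv_def)
    moreover have "(mv g {}, mv g {e0}) \<in> ?T" using g by (auto simp: adj_def)
    ultimately show ?thesis using g by (auto intro: rtrancl_into_rtrancl)
  qed
  have "(p, q) \<in> ?T\<^sup>*" using base[OF assms(2)] sym[OF base[OF assms(1)]] by (rule rtrancl_trans[rotated])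
  then show ?thesis using reach_geo assms by blast
qed

lemma finite_sep: 
  assumes "p \<in> V" "q \<in> V" shows "finite (sep p q)"
  using V_connected[OF assms]
proof (induction rule: geo.induct)
  case (geo_cons e p p' q)
  have "sep p q \<subseteq> insert e (sep p' q)" using sep_adj'[OF geo_cons.hyps(1)] by blast
  then show ?case using geo_cons finite_subset by blast
qed simp

lemma first_edge:
  assumes "p \<in> V" "q \<in> V" "p \<noteq> q"
  obtains e p' where "adj e p p'" "e \<in> sep p q"
  using V_connected[OF assms(1,2)]
proof cases
  case (geo_cons e p')
  then have "e \<in> sep p q" using adj_flip by blast
  then show ?thesis using that geo_cons by blast
qed (use assms in simp)

lemma card_sep_adj:
  assumes "adj e p p'" "e \<in> sep p q" "q \<in> V"
  shows "card (sep p q) = Suc (card (sep p' q))"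
  using sep_adj[OF assms(1,2)] finite_sep[OF adj_closed(3)[OF assms(1)] assms(3)] by simp

text \<open>
  Since a geodesic from \<open>a\<close> to \<open>b\<close> across \<open>e\<close> runs through the near end \<open>x\<close> of \<open>e\<close>, its initial part is
  a geodesic from \<open>a\<close> to \<open>x\<close>. The arguments about trees below rest on this inclusion.
\<close>
lemma gate:
  assumes "a \<in> V" "b \<in> V" "e \<in> sep a b" "adj e x y" "e \<notin> sep a x"
  shows "sep a x \<subseteq> sep a b"
  using geo_gate[OF V_connected] assms by blast

lemma adj_side:
  assumes "e \<in> E"
  obtains x y where "adj e x y" "e \<notin> sep a x"
proof -
  obtain x y where xy: "adj e x y" using adj_exists[OF assms] by blast
  then have "e \<notin> sep a x \<or> e \<notin> sep a y" using adj_flip[OF xy, of a] by (simp add: sep_commute)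
  then show ?thesis using xy adj_sym that by blast
qed

text \<open>
  Two edges never cross: if \<open>f\<close> separates \<open>a\<close> from \<open>b\<close> and \<open>c\<close> from \<open>d\<close> on one side of \<open>e\<close> each, with
  \<open>a\<close> and \<open>c\<close> on the same side of \<open>f\<close>, then both geodesics run through the end of \<open>f\<close> on that side.
  So \<open>a\<close> and \<open>c\<close> are both on the side of \<open>e\<close> on which this end lies.
\<close>
lemma no_crossing:
  assumes V: "a \<in> V" "b \<in> V" "c \<in> V" "d \<in> V"
    and ab: "f \<in> sep a b" "e \<notin> sep a b" and cd: "f \<in> sep c d" "e \<notin> sep c d" and ac: "f \<notin> sep a c"
  shows "e \<notin> sep a c"
proof -
  have "f \<in> E" using sep_sub[OF V(1,2)] ab by blast
  then obtain x y where xy: "adj f x y" "f \<notin> sep a x" using adj_side by blast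
  have "sep a x \<subseteq> sep a b" using gate V ab xy by blast
  moreover have "f \<notin> sep c x" using ac xy(2) unfolding mem_sep by blast
  then have "sep c x \<subseteq> sep c d" using gate V cd xy by blast
  ultimately have "e \<notin> sep a x" "e \<notin> sep c x" using ab cd by auto
  then show ?thesis unfolding mem_sep by blast
qed

lemma first_edge_unique:
  assumes "adj e p p'" "adj f p p''" "q \<in> V" "e \<in> sep p q" "f \<in> sep p q"
  shows "e = f"
proof (rule ccontr)
  assume ne: "e \<noteq> f"
  have V: "p' \<in> V" using adj_closed assms(1) by blast
  have "f \<in> sep p' q" using sep_adj'[OF assms(1)] ne assms(5) by auto
  moreover have s: "sep p' p = {e}" using adj_sep[OF adj_sym[OF assms(1)]] .
  ultimately have "sep p' p \<subseteq> sep p' q"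
    using gate[OF V assms(3) _ assms(2)] ne by auto
  then show False using s sep_adj(2)[OF assms(1,4)] by simp
qed

text \<open>
  Both geodesics run through the near end of \<open>e\<close>, and so they agree up to this end.
\<close>
lemma common_first_edge:
  assumes V: "a \<in> V" "b \<in> V" "c \<in> V" and e: "e \<in> sep a b" "e \<in> sep a c"
  obtains f a' where "adj f a a'" "f \<in> sep a b" "f \<in> sep a c"
proof -
  have "e \<in> E" using sep_sub V e by blast
  then obtain x y where xy: "adj e x y" "e \<notin> sep a x" using adj_side by blast
  have sub: "sep a x \<subseteq> sep a b" "sep a x \<subseteq> sep a c" using gate V e xy by blast+
  show ?thesis
  proof (cases "a = x")
    case True
    then show ?thesis using that xy e by blast
  next
    case False
    have "x \<in> V" using xy adj_closed by blast
    then obtain f a' where "adj f a a'" "f \<in> sep a x" using first_edge V(1) False by blast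
    then show ?thesis using that sub by blast
  qed
qed

section \<open>Elliptic elements\<close>

definition Fix :: "'g \<Rightarrow> 'e set set" where
  "Fix u = {p \<in> V. mv u p = p}"

text \<open>
  The first edge of the geodesic from \<open>p\<close> to \<open>q\<close> is unique, so it is fixed if \<open>p\<close> and \<open>q\<close> are; as there
  are no inversions, its other end is fixed too, and one proceeds along the geodesic.
\<close>
lemma fix_convex:
  assumes u: "u \<in> carrier G"
  shows "p \<in> Fix u \<Longrightarrow> q \<in> Fix u \<Longrightarrow> e \<in> sep p q \<Longrightarrow> act u e = e"
proof (induction "card (sep p q)" arbitrary: p rule: less_induct)
  case less
  have V: "p \<in> V" "q \<in> V" and fixed: "mv u p = p" "mv u q = q" using less.prems by (auto simp: Fix_def)
  have "p \<noteq> q" using less.prems(3) by (auto simp: mem_sep)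
  then obtain f p' where f: "adj f p p'" "f \<in> sep p q" using first_edge V by blast
  have fE: "f \<in> E" using f adj_closed by blast
  have "adj (act u f) p (mv u p')" using adj_mv[OF u f(1)] fixed by simp
  moreover have "act u f \<in> sep p q" using act_mem_sep_mv[OF u V fE] f(2) fixed by simp
  ultimately have uf: "act u f = f" using first_edge_unique f V(2) by blast
  have "p' \<in> Fix u"
    using adj_fixed[OF u uf adj_sym[OF f(1)]] adj_closed(3)[OF f(1)] by (simp add: Fix_def)
  moreover have "card (sep p' q) < card (sep p q)" using card_sep_adj[OF f V(2)] by simp
  moreover have "e = f \<or> e \<in> sep p' q" using sep_adj(1)[OF f] less.prems(3) by auto
  ultimately show ?case using less.hyps less.prems(2) uf by blast
qed

text \<open>
  The vertex \<open>p\<close> is the fixed vertex closest to \<open>q\<close>: a common edge of the two geodesics would yield a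
  common first edge, whose other end would be fixed and closer to \<open>q\<close>.
\<close>
lemma fix_projection:
  assumes x: "x \<in> carrier G" and ne: "Fix x \<noteq> {}" and q: "q \<in> V"
  obtains p where "p \<in> Fix x" "\<And>r. r \<in> Fix x \<Longrightarrow> sep p r \<inter> sep p q = {}"
proof -
  obtain p where p: "p \<in> Fix x" and min: "\<And>r. r \<in> Fix x \<Longrightarrow> card (sep p q) \<le> card (sep r q)"
    using ex_has_least_nat[of "\<lambda>p. p \<in> Fix x" _ "\<lambda>p. card (sep p q)"] ne by (meson equals0I)
  have "sep p r \<inter> sep p q = {}" if r: "r \<in> Fix x" for r
  proof (rule ccontr)
    assume "sep p r \<inter> sep p q \<noteq> {}"
    then obtain e where "e \<in> sep p r" "e \<in> sep p q" by blast
    moreover have "p \<in> V" "r \<in> V" using p r by (auto simp: Fix_def)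
    ultimately obtain f p' where f: "adj f p p'" "f \<in> sep p r" "f \<in> sep p q"
      using common_first_edge q by blast
    have "p' \<in> Fix x"
      using adj_fixed[OF x fix_convex[OF x p r f(2)] adj_sym[OF f(1)]] adj_closed(3)[OF f(1)]
      by (simp add: Fix_def)
    then show False using min[of p'] card_sep_adj[OF f(1,3) q] by simp
  qed
  then show ?thesis using that p by blast
qed

text \<open>
  Let \<open>p\<close> be the projection to \<open>Fix x\<close> of a vertex \<open>q\<close> fixed by \<open>y\<close>. As \<open>y\<close> commutes with \<open>x\<close>, the vertex
  \<open>y p\<close> is fixed by \<open>x\<close>, and it is as far from \<open>q\<close> as \<open>p\<close> is. The geodesic from \<open>y p\<close> to \<open>q\<close> runs through
  \<open>p\<close>, hence \<open>y p = p\<close>.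
\<close>
lemma commuting_fix:
  assumes x: "x \<in> carrier G" and y: "y \<in> carrier G" and comm: "x \<otimes> y = y \<otimes> x"
    and ne: "Fix x \<noteq> {}" "Fix y \<noteq> {}"
  shows "Fix x \<inter> Fix y \<noteq> {}"
proof -
  obtain q where q: "q \<in> V" "mv y q = q" using ne by (auto simp: Fix_def)
  obtain p where p: "p \<in> Fix x" "\<And>r. r \<in> Fix x \<Longrightarrow> sep p r \<inter> sep p q = {}"
    using fix_projection[OF x ne(1) q(1)] by blast
  have pV: "p \<in> V" "mv x p = p" using p(1) by (auto simp: Fix_def)
  have "mv x (mv y p) = mv y p"
    using pV mv_mult_V[OF x y, of p] mv_mult_V[OF y x, of p] comm by simp
  then have "sep p (mv y p) \<inter> sep p q = {}"
    using p(2) mv_closed[OF y pV(1)] by (auto simp: Fix_def)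
  moreover have "sep (mv y p) q = sep (sep p (mv y p)) (sep p q)" by (auto simp: mem_sep)
  ultimately have "sep (mv y p) q = sep p (mv y p) \<union> sep p q" by (auto simp: sep_def)
  then have "card (sep (mv y p) q) = card (sep p (mv y p)) + card (sep p q)"
    using card_Un_disjoint[OF finite_sep finite_sep] pV q mv_closed[OF y pV(1)]
      \<open>sep p (mv y p) \<inter> sep p q = {}\<close> by simp
  moreover have "card (sep (mv y p) q) = card (sep p q)"
    using card_sep_mv[OF y pV(1) q(1)] q by simp
  ultimately have "sep p (mv y p) = {}"
    using finite_sep[OF pV(1) mv_closed[OF y pV(1)]] by simp
  then have "p \<in> Fix y" using pV by (simp add: Fix_def)
  then show ?thesis using p by blast
qed

section \<open>Hyperbolic elements\<close>

text \<open>
  The side of \<open>e\<close> on which \<open>p\<close> lies.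
\<close>
definition half :: "'e \<Rightarrow> 'e set \<Rightarrow> 'e set set" where
  "half e p = {q \<in> V. e \<notin> sep p q}"

text \<open>
  The edges on the axis of a hyperbolic element are exactly those of which it maps one side properly
  into itself. In this form the axis is visibly invariant under the centralizer.
\<close>
definition axis_edge :: "'g \<Rightarrow> 'e \<Rightarrow> bool" where
  "axis_edge v e \<longleftrightarrow> e \<in> E \<and> (\<exists>p\<in>V. mv v ` half e p \<subset> half e p)"

lemma mv_half:
  assumes "g \<in> carrier G" "e \<in> E" "p \<in> V"
  shows "mv g ` half e p = half (act g e) (mv g p)"
proof (intro equalityI subsetI)
  fix q assume "q \<in> mv g ` half e p"
  then show "q \<in> half (act g e) (mv g p)"
    using assms act_mem_sep_mv mv_closed by (auto simp: half_def)
next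
  fix q assume q: "q \<in> half (act g e) (mv g p)"
  let ?r = "mv (inv g) q"
  have "q \<in> V" "act g e \<notin> sep (mv g p) q" using q by (auto simp: half_def)
  moreover have "?r \<in> V" using assms calculation mv_closed by simp
  ultimately have "?r \<in> half e p" "mv g ?r = q"
    using act_mem_sep_mv[OF assms(1,3) \<open>?r \<in> V\<close> assms(2)] assms by (auto simp: half_def)
  then show "q \<in> mv g ` half e p" by force
qed

lemma half_eq: "q \<in> half e p \<Longrightarrow> half e q = half e p"
  by (auto simp: half_def mem_sep)

text \<open>
  A vertex of minimal displacement lies on the axis, so the geodesics from \<open>p\<close> to \<open>v p\<close> and on to \<open>v v p\<close>
  do not backtrack. If they did, their common first edge \<open>f\<close> at \<open>v p\<close> and its translate \<open>g\<close> at \<open>p\<close> could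
  both be cut off, which decreases the displacement by two, unless \<open>f = g\<close>. In that case \<open>v\<close> fixes an
  edge and therefore a vertex.
\<close>
lemma minimal_displacement:
  assumes v: "v \<in> carrier G" and nofix: "Fix v = {}"
    and p: "p \<in> V" and min: "\<And>q. q \<in> V \<Longrightarrow> card (sep p (mv v p)) \<le> card (sep q (mv v q))"
  shows "sep p (mv v p) \<inter> sep (mv v p) (mv v (mv v p)) = {}"
proof (rule ccontr)
  let ?a = "mv v p" and ?b = "mv v (mv v p)"
  assume "\<not> ?thesis"
  then obtain e where "e \<in> sep ?a p" "e \<in> sep ?a ?b" by (auto simp: sep_commute)
  moreover have V: "?a \<in> V" "?b \<in> V" using mv_closed v p by auto
  ultimately obtain f q where f: "adj f ?a q" "f \<in> sep ?a p" "f \<in> sep ?a ?b"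
    using common_first_edge p by blast
  define r where "r = mv (inv v) q"
  define g where "g = act (inv v) f"
  have fE: "f \<in> E" and qV: "q \<in> V" using f adj_closed by blast+
  have r: "r \<in> V" "mv v r = q" using qV v mv_closed by (auto simp: r_def)
  have g: "act v g = f" "g \<in> E" using act_inv'[OF v fE] fE act_closed v by (auto simp: g_def)
  have adj_g: "adj g p r" using adj_mv[OF inv_closed[OF v] f(1)] v p by (simp add: r_def g_def)
  have "g \<in> sep p ?a" using act_mem_sep_mv[OF v p V(1) g(2)] g(1) f(3) by simp
  show False
  proof (cases "g = f")
    case True
    then have "p = ?a \<or> mv v p = p"
      using adj_fixed[OF v _ adj_g] g(1) by blast
    then show False using nofix p by (auto simp: Fix_def)
  next
    case False
    have "f \<in> sep r ?a" using sep_adj'[OF adj_g, of f ?a] False f(2) by (auto simp: sep_commute)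
    moreover have "card (sep p ?a) = Suc (card (sep r ?a))"
      using card_sep_adj[OF adj_g \<open>g \<in> sep p ?a\<close> V(1)] .
    moreover have "card (sep ?a r) = Suc (card (sep q r))"
      using card_sep_adj[OF f(1) _ r(1)] calculation(1) by (simp add: sep_commute)
    ultimately show False using min[OF r(1)] r(2) by (simp add: sep_commute)
  qed
qed

text \<open>
  If \<open>p\<close> has minimal displacement, any edge \<open>e\<close> between \<open>p\<close> and \<open>v p\<close> is on the axis. The vertices \<open>p\<close>, \<open>v p\<close> and \<open>v v p\<close> show that three
  of the four intersections of sides of \<open>e\<close> and \<open>v e\<close> are inhabited; as edges do not cross, the fourth
  one is empty.
\<close>
lemma axis_edge_exists:
  assumes v: "v \<in> carrier G" and nofix: "Fix v = {}"
  shows "\<exists>e. axis_edge v e"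
proof -
  have "{} \<in> V" using mv_V_base(1)[of \<one>] mv_one by simp
  then obtain p where p: "p \<in> V" and "\<And>q. q \<in> V \<Longrightarrow> card (sep p (mv v p)) \<le> card (sep q (mv v q))"
    using ex_has_least_nat[of "\<lambda>p. p \<in> V" _ "\<lambda>p. card (sep p (mv v p))"] by blast
  then have disj: "sep p (mv v p) \<inter> sep (mv v p) (mv v (mv v p)) = {}"
    using minimal_displacement[OF v nofix] by blast
  let ?a = "mv v p" and ?b = "mv v (mv v p)"
  have V: "?a \<in> V" "?b \<in> V" using mv_closed v p by auto
  have "p \<noteq> ?a" using nofix p by (auto simp: Fix_def)
  then obtain e where e: "e \<in> sep p ?a" by (auto simp: set_eq_iff mem_sep)
  have eE: "e \<in> E" using e sep_sub p V by blast
  have f: "act v e \<in> sep ?a ?b" using act_mem_sep_mv[OF v p V(1) eE] e by simp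
  let ?f = "act v e"
  have half: "mv v ` half e ?a = half ?f ?b" using mv_half v eE V by simp
  have "half ?f ?b \<subseteq> half e ?a"
  proof
    fix r assume "r \<in> half ?f ?b"
    then have r: "r \<in> V" "?f \<notin> sep ?b r" by (auto simp: half_def)
    have "e \<notin> sep ?a r"
    proof
      assume "e \<in> sep ?a r"
      then have "e \<notin> sep p r" using e by (auto simp: mem_sep)
      moreover have "?f \<notin> sep p ?a" using disj f by blast
      moreover have "?f \<in> sep p r" using r(2) f \<open>?f \<notin> sep p ?a\<close> by (auto simp: mem_sep)
      moreover have "e \<notin> sep ?a ?b" using disj e by blast
      ultimately have "e \<notin> sep p ?a" using no_crossing[OF p r(1) V] f by blast
      then show False using e by simp
    qed
    then show "r \<in> half e ?a" using r by (simp add: half_def)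
  qed
  moreover have "?a \<in> half e ?a" "?a \<notin> half ?f ?b"
    using V f by (auto simp: half_def mem_sep)
  ultimately have "mv v ` half e ?a \<subset> half e ?a" unfolding half by blast
  then show ?thesis using eE V(1) unfolding axis_edge_def by blast
qed

lemma axis_edge_centralizer:
  assumes x: "x \<in> carrier G" and v: "v \<in> carrier G" and comm: "x \<otimes> v = v \<otimes> x"
    and e: "axis_edge v e"
  shows "axis_edge v (act x e)"
proof -
  obtain p where p: "p \<in> V" "mv v ` half e p \<subset> half e p" and eE: "e \<in> E"
    using e by (auto simp: axis_edge_def)
  have VH: "half e p \<subseteq> V" by (auto simp: half_def)
  have "mv v ` half (act x e) (mv x p) = mv v ` mv x ` half e p"
    using mv_half[OF x eE p(1)] by simp
  also have "\<dots> = mv x ` mv v ` half e p"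
    unfolding image_image
    by (intro image_cong refl) (metis VH comm mv_mult_V subsetD v x)
  also have "\<dots> \<subset> mv x ` half e p"
  proof -
    have "inj_on (mv x) (half e p)" 
      by (rule inj_on_inverseI[where g = "mv (inv x)"]) (use VH x in auto)
    then show ?thesis using p(2) by (rule image_strict_mono)
  qed
  finally show ?thesis
    unfolding axis_edge_def mv_half[OF x eE p(1)]
    using mv_closed[OF x p(1)] act_closed[OF x eE] by blast
qed

lemma pow_mv_Suc: "w \<in> carrier G \<Longrightarrow> p \<in> V \<Longrightarrow> mv (w [^] Suc n) p = mv (w [^] n) (mv w p)"
  "w \<in> carrier G \<Longrightarrow> p \<in> V \<Longrightarrow> mv (w [^] Suc n) p = mv w (mv (w [^] n) p)"
  using mv_mult_V[of "w [^] n" w p] mv_mult_V[of w "w [^] n" p]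
  by (simp_all add: nat_pow_Suc2[symmetric])

text \<open>
  The powers of \<open>w\<close> push every vertex into a half that \<open>w\<close> shrinks. Otherwise all edges \<open>(inv w)^n e\<close>
  would separate \<open>p\<close> from a vertex of the half. There are only finitely many such edges, so some
  power of \<open>w\<close> would fix \<open>e\<close>, and such a power cannot shrink a half at \<open>e\<close>.
\<close>
lemma half_absorbs:
  assumes w: "w \<in> carrier G" and e: "e \<in> E" and a: "a \<in> V" and sub: "mv w ` half e a \<subset> half e a"
    and p: "p \<in> V"
  shows "\<exists>n::nat. mv (w [^] n) p \<in> half e a"
proof (rule ccontr)
  assume no: "\<nexists>n::nat. mv (w [^] n) p \<in> half e a"
  let ?i = "\<lambda>n::nat. inv (w [^] n)"
  have cl: "w [^] n \<in> carrier G" "?i n \<in> carrier G" for n :: nat using w by simp_all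
  have iter: "mv (w [^] n) q \<in> half e a" if "q \<in> half e a" for q and n :: nat
  proof (induction n)
    case 0
    then show ?case using that mv_one_V[of q] by (simp add: half_def)
  next
    case (Suc n)
    have "q \<in> V" using that by (simp add: half_def)
    then show ?case using Suc sub pow_mv_Suc(2)[OF w] by fastforce
  qed
  have iter': "mv (w [^] Suc n) q \<in> mv w ` half e a" if "q \<in> half e a" for q and n :: nat
    using iter[OF that] pow_mv_Suc(2)[OF w, of q n] that by (auto simp: half_def)
  obtain q where q: "q \<in> half e a" using sub by blast
  have qV: "q \<in> V" using q by (simp add: half_def)
  have "act (?i n) e \<in> sep p q" for n
  proof -
    have "e \<in> sep (mv (w [^] n) p) (mv (w [^] n) q)"
      using no iter[OF q, of n] mv_closed[OF cl(1) p, of n] by (auto simp: half_def mem_sep)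
    then show ?thesis
      using act_mem_sep_mv[OF cl(1) p qV, of "act (?i n) e" n] act_inv'[OF cl(1) e]
        act_closed[OF cl(2) e] by simp
  qed
  then have "range (\<lambda>n. act (?i n) e) \<subseteq> sep p q" by blast
  then have "finite (range (\<lambda>n. act (?i n) e))" using finite_sep[OF p qV] finite_subset by blast
  then have "\<not> inj (\<lambda>n. act (?i n) e)" using finite_imageD infinite_UNIV_nat by blast
  then obtain i' j' where "i' \<noteq> j'" "act (?i i') e = act (?i j') e" unfolding inj_def by blast
  then obtain i j where ij: "i < j" "act (?i i) e = act (?i j) e"
    using that[of i' j'] that[of j' i'] by (cases "i' < j'") simp_all
  \<comment> \<open>\<open>w^(k + 1)\<close> fixes \<open>e\<close>; the positive exponent makes its image of the half lie in that of \<open>w\<close>\<close>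
  define k where "k = j - i - 1"
  have j: "w [^] j = w [^] Suc k \<otimes> w [^] i"
    using ij(1) w by (simp only: nat_pow_mult) (simp add: k_def)
  have "act (w [^] j) (act (?i j) e) = act (w [^] Suc k) (act (w [^] i) (act (?i i) e))"
    using act_mult[OF cl(1) cl(1) act_closed[OF cl(2) e]] j ij by metis
  then have fixed: "act (w [^] Suc k) e = e" using act_inv'[OF cl(1) e] by simp
  obtain x y where xy: "adj e x y" "e \<notin> sep a x" using adj_side[OF e] by blast
  have x: "x \<in> half e a" using xy adj_closed by (auto simp: half_def)
  have "mv (w [^] Suc k) x = x" using adj_fixed[OF cl(1) fixed xy(1)] .
  then have "x \<in> mv w ` half e a" using iter'[OF x, of k] by simp
  then have x1: "x \<in> half (act w e) (mv w a)" using mv_half[OF w e a] by simp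
  have "half e a \<subseteq> mv w ` half e a"
  proof
    fix r assume r: "r \<in> half e a"
    have rV: "r \<in> V" using r by (simp add: half_def)
    let ?r = "mv (inv (w [^] Suc k)) r"
    have "?r \<in> half e a"
    proof -
      have "mv (w [^] Suc k) ` half e x = half e x"
        using mv_half[OF cl(1) e] fixed \<open>mv (w [^] Suc k) x = x\<close> x by (metis (no_types, lifting) half_def mem_Collect_eq)
      then obtain s where "s \<in> half e x" "r = mv (w [^] Suc k) s"
        using r half_eq[OF x] by blast
      then show ?thesis using half_eq[OF x] mv_inv_V(1)[OF cl(1), of s "Suc k"] by (auto simp: half_def)
    qed
    then show "r \<in> mv w ` half e a" using iter'[of ?r k] mv_inv_V(2)[OF cl(1) rV, of "Suc k"] by simp
  qed
  then show False using sub by blast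
qed

section \<open>Centralizers of hyperbolic elements\<close>

lemma iterate_sep:
  fixes n :: nat
  assumes w: "w \<in> carrier G" and p: "p \<in> V"
  shows "e \<in> sep p (mv (w [^] n) p) \<Longrightarrow> \<exists>i::nat. e \<in> act (w [^] i) ` sep p (mv w p)"
proof (induction n)
  case 0
  then show ?case using mv_one_V[OF p] by simp
next
  case (Suc n)
  have wn: "w [^] n \<in> carrier G" using w by simp
  have "sep (mv (w [^] n) p) (mv (w [^] Suc n) p) = act (w [^] n) ` sep p (mv w p)"
    unfolding pow_mv_Suc(1)[OF w p] using sep_mv_V[OF wn p mv_closed[OF w p]] .
  moreover have "e \<in> sep p (mv (w [^] n) p) \<or> e \<in> sep (mv (w [^] n) p) (mv (w [^] Suc n) p)"
    using Suc.prems unfolding mem_sep by blast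
  ultimately show ?case using Suc.IH by metis
qed

text \<open>
  The axis has only finitely many edges up to the powers of \<open>v\<close>, since each of them has a translate
  between \<open>p\<close> and \<open>v p\<close>: the side of \<open>e\<close> that \<open>v\<close> shrinks absorbs \<open>p\<close> under powers of \<open>v\<close>, and the other
  side, which the inverse of \<open>v\<close> shrinks, absorbs \<open>p\<close> under powers of the inverse. In passing from one
  side to the other, the orbit of \<open>p\<close> crosses \<open>e\<close>.
\<close>
lemma axis_edge_orbit:
  assumes v: "v \<in> carrier G" and Z: "subgroup Z G" "v \<in> Z" and e: "axis_edge v e" and p: "p \<in> V"
  shows "\<exists>z\<in>Z. \<exists>s\<in>sep p (mv v p). e = act z s"
proof -
  obtain a where a: "a \<in> V" and sub: "mv v ` half e a \<subset> half e a" and eE: "e \<in> E"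
    using e by (auto simp: axis_edge_def)
  let ?w = "inv v"
  have w: "?w \<in> carrier G" using v by simp
  have pow: "z [^] i \<in> Z" if "z \<in> Z" for z and i :: nat
    using that Z by (induction i) (auto simp: subgroup.one_closed subgroup.m_closed)
  obtain n :: nat where n: "mv (v [^] n) p \<in> half e a"
    using half_absorbs[OF v eE a sub p] by blast
  obtain b where b: "b \<in> half e a" "b \<notin> mv v ` half e a" using sub by blast
  let ?b = "mv ?w b"
  have bV: "b \<in> V" "?b \<in> V" using b mv_closed w by (auto simp: half_def)
  have b': "?b \<notin> half e a" using b(2) mv_inv_V(2)[OF v bV(1)] by (metis imageI)
  have compl: "r \<in> half e ?b \<longleftrightarrow> r \<in> V \<and> r \<notin> half e a" for r
    using b' bV(2) by (auto simp: half_def mem_sep)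
  have "mv ?w ` half e ?b \<subset> half e ?b"
  proof
    show "mv ?w ` half e ?b \<subseteq> half e ?b"
    proof
      fix x assume "x \<in> mv ?w ` half e ?b"
      then obtain r where r: "r \<in> V" "r \<notin> half e a" "x = mv ?w r" using compl by blast
      have "x \<notin> half e a"
      proof
        assume "x \<in> half e a"
        then have "mv v x \<in> half e a" using sub by blast
        then show False using r mv_inv_V(2)[OF v r(1)] by simp
      qed
      then show "x \<in> half e ?b" using compl r mv_closed[OF w r(1)] by simp
    qed
    have "?b \<in> half e ?b" using compl b' bV by blast
    moreover have "?b \<notin> mv ?w ` half e ?b"
    proof
      assume "?b \<in> mv ?w ` half e ?b"
      then obtain r where r: "r \<in> V" "r \<notin> half e a" "?b = mv ?w r" using compl by blast
      then have "b = r" using mv_inv_V(2)[OF v] bV(1) by metis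
      then show False using r b by simp
    qed
    ultimately show "mv ?w ` half e ?b \<noteq> half e ?b" by blast
  qed
  then obtain m :: nat where m: "mv (?w [^] m) p \<in> half e ?b"
    using half_absorbs[OF w eE bV(2) _ p] by blast
  then have "mv (?w [^] m) p \<notin> half e a" "mv (?w [^] m) p \<in> V" using compl by blast+
  then have "e \<in> sep p (mv (v [^] n) p) \<or> e \<in> sep p (mv (?w [^] m) p)"
    using n by (auto simp: half_def mem_sep)
  then show ?thesis
  proof
    assume "e \<in> sep p (mv (v [^] n) p)"
    then show ?thesis using iterate_sep[OF v p] pow[OF Z(2)] by blast
  next
    assume "e \<in> sep p (mv (?w [^] m) p)"
    then obtain i :: nat and s where s: "s \<in> sep p (mv ?w p)" "e = act (?w [^] i) s"
      using iterate_sep[OF w p] by blast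
    have sE: "s \<in> E" using s sep_sub[OF p mv_closed[OF w p]] by blast
    have "act v s \<in> sep (mv v p) p"
      using act_mem_sep_mv[OF v p mv_closed[OF w p] sE] s(1) mv_inv_V(2)[OF v p] by simp
    moreover have "e = act (?w [^] i \<otimes> ?w) (act v s)"
      using act_mult[of "?w [^] i" ?w "act v s"] w act_closed[OF v sE] act_inv[OF v sE] s(2) by simp
    moreover have "?w [^] i \<otimes> ?w \<in> Z"
      using pow[of ?w i] Z by (simp add: subgroup.m_closed subgroup.m_inv_closed)
    ultimately show ?thesis by (auto simp: sep_commute)
  qed
qed

text \<open>
  An element that commutes with \<open>v\<close> permutes the edges of the axis. They form finitely many orbits
  under \<open>Z\<close>, so by the pigeonhole principle two powers of \<open>x\<close> move \<open>e\<close> into the same orbit, and their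
  quotient acts on \<open>e\<close> like an element of \<open>Z\<close>.
\<close>
lemma power_acts_as_axis_symmetry:
  assumes v: "v \<in> carrier G" and x: "x \<in> carrier G" "x \<otimes> v = v \<otimes> x" and e: "axis_edge v e"
    and Z: "subgroup Z G" "v \<in> Z" "\<And>z. z \<in> Z \<Longrightarrow> z \<otimes> x = x \<otimes> z"
  shows "\<exists>m::nat. \<exists>z\<in>Z. 0 < m \<and> act (x [^] m) e = act z e"
proof -
  have eE: "e \<in> E" using e by (simp add: axis_edge_def)
  have Zc: "z \<in> carrier G" if "z \<in> Z" for z
    using subgroup.mem_carrier[OF Z(1) that] .
  have xp: "x [^] i \<in> carrier G" "x [^] i \<otimes> v = v \<otimes> x [^] i" for i :: nat
    using x v by (simp_all add: group_commutes_pow)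
  have zx: "z \<otimes> x [^] i = x [^] i \<otimes> z" if "z \<in> Z" for z and i :: nat
    using group_commutes_pow[of x z i] Z(3)[OF that] x(1) Zc[OF that] by simp
  have "{} \<in> V" using mv_V_base(1)[of \<one>] mv_one by simp
  then obtain p where p: "p \<in> V" by blast
  let ?F = "sep p (mv v p)"
  have F: "finite ?F" "?F \<subseteq> E" using finite_sep sep_sub p mv_closed[OF v p] by auto
  have "\<forall>i::nat. \<exists>s\<in>?F. \<exists>z\<in>Z. act (x [^] i) e = act z s"
    using axis_edge_orbit[OF v Z(1,2) axis_edge_centralizer[OF xp(1) v xp(2) e] p] by blast
  then obtain s where s: "\<And>i::nat. s i \<in> ?F" "\<And>i. \<exists>z\<in>Z. act (x [^] i) e = act z (s i)" by metis
  have "\<not> inj s"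
    using F(1) s(1) finite_subset[of "range s" ?F] finite_imageD infinite_UNIV_nat by blast
  then obtain i' j' where "i' \<noteq> j'" "s i' = s j'" unfolding inj_def by blast
  then obtain i j where ij: "i < j" "s i = s j"
    using that[of i' j'] that[of j' i'] by (cases "i' < j'") simp_all
  obtain y z where yz: "y \<in> Z" "z \<in> Z" "act (x [^] i) e = act y (s i)" "act (x [^] j) e = act z (s i)"
    using s(2)[of i] s(2)[of j] ij(2) by auto
  have siE: "s i \<in> E" using s(1) F by blast
  let ?z = "z \<otimes> inv y" and ?m = "j - i"
  have zZ: "?z \<in> Z" using yz Z(1) by (simp add: subgroup.m_closed subgroup.m_inv_closed)
  note c = Zc[OF yz(1)] Zc[OF yz(2)] Zc[OF zZ] xp(1)
  have "act (x [^] i) (act (x [^] ?m) e) = act (x [^] j) e"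
    using act_mult[OF c(4) c(4) eE, of i ?m] ij(1) x(1) by (simp add: nat_pow_mult)
  also have "\<dots> = act ?z (act (x [^] i) e)"
    using yz(3,4) act_mult[of z "inv y" "act y (s i)"] c act_closed[OF c(1) siE] act_inv[OF c(1) siE] by simp
  also have "\<dots> = act (x [^] i) (act ?z e)"
    using act_mult[OF c(3) c(4) eE] act_mult[OF c(4) c(3) eE] zx[OF zZ] by metis
  finally have "act (x [^] ?m) e = act ?z e"
    using act_eq_iff[OF c(4) act_closed[OF c(4) eE] act_closed[OF c(3) eE]] by blast
  then show ?thesis using zZ ij(1) by (intro exI[of _ ?m] bexI[of _ ?z]) auto
qed

end

text \<open>
  Separating a graph by a clique, where \<open>K\<close> may be empty: \<open>K\<close> is then the witness that the graph is
  disconnected. Vertices in \<open>K\<close> are pairwise adjacent, vertices in \<open>S\<close> and \<open>T\<close> never.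
\<close>
definition clique_cut :: "'x set \<Rightarrow> ('x \<Rightarrow> 'x \<Rightarrow> bool) \<Rightarrow> 'x set \<Rightarrow> 'x set \<Rightarrow> 'x set \<Rightarrow> bool" where
  "clique_cut X R K S T \<longleftrightarrow>
     K \<union> S \<union> T = X \<and> K \<inter> S = {} \<and> K \<inter> T = {} \<and> S \<inter> T = {} \<and> S \<noteq> {} \<and> T \<noteq> {} \<and>
     (\<forall>x\<in>K. \<forall>y\<in>K. x \<noteq> y \<longrightarrow> R x y) \<and> (\<forall>s\<in>S. \<forall>t\<in>T. \<not> R s t)"

text \<open>
  As all edges are translates of \<open>e0\<close>, their stabilizers are conjugate, and each of them is abelian
  (\<open>stabilizer_commutes\<close>).
\<close>
locale abelian_tree_action = tree_action G E act e0 D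
  for G :: "('g, 'm) monoid_scheme" (structure) and E :: "'e set" and act e0 D +
  assumes abelian_stabilizer: "g \<in> carrier G \<Longrightarrow> h \<in> carrier G \<Longrightarrow> act g e0 = e0 \<Longrightarrow>
    act h e0 = e0 \<Longrightarrow> g \<otimes> h = h \<otimes> g"
begin

lemma stabilizer_commutes:
  assumes g: "g \<in> carrier G" "act g e = e" and h: "h \<in> carrier G" "act h e = e" and e: "e \<in> E"
  shows "g \<otimes> h = h \<otimes> g"
proof -
  obtain k where k: "k \<in> carrier G" "e = act k e0" using transitive[OF e] by blast
  let ?c = "\<lambda>x. inv k \<otimes> x \<otimes> k"
  have fixed: "act (?c x) e0 = e0" if "x \<in> carrier G" "act x e = e" for x
    using that k e0 e by (simp add: act_mult act_inv)
  have "?c g \<otimes> ?c h = ?c h \<otimes> ?c g"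
    using g h k by (intro abelian_stabilizer fixed) auto
  moreover have "?c x \<otimes> ?c y = ?c (x \<otimes> y)" if "x \<in> carrier G" "y \<in> carrier G" for x y
  proof -
    have "k \<otimes> (inv k \<otimes> (y \<otimes> k)) = y \<otimes> k" using that k by (simp add: m_assoc[symmetric])
    then show ?thesis using that k by (simp add: m_assoc)
  qed
  ultimately have "?c (g \<otimes> h) = ?c (h \<otimes> g)" using g h by simp
  then show ?thesis using g h k by simp
qed

text \<open>
  Powers of \<open>x\<close> and \<open>y\<close> act on one edge \<open>e\<close> of the axis of \<open>v\<close> like elements \<open>z\<close> and \<open>w\<close> of the double
  centralizer of \<open>v\<close>. Dividing by \<open>z\<close> and \<open>w\<close> gives elements of the abelian stabilizer of \<open>e\<close>, and as
  \<open>z\<close> and \<open>w\<close> commute with everything in sight, the powers themselves commute.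
\<close>
lemma hyperbolic_centralizer_powers:
  assumes v: "v \<in> carrier G" and nofix: "Fix v = {}"
    and x: "x \<in> carrier G" "x \<otimes> v = v \<otimes> x" and y: "y \<in> carrier G" "y \<otimes> v = v \<otimes> y"
  shows "\<exists>(m::nat) (n::nat). 0 < m \<and> 0 < n \<and> x [^] m \<otimes> y [^] n = y [^] n \<otimes> x [^] m"
proof -
  \<comment> \<open>\<open>Z\<close> is the double centralizer of \<open>v\<close>: it contains \<open>v\<close> and commutes with \<open>x\<close>, \<open>y\<close> and itself\<close>
  define Cv where "Cv = {g \<in> carrier G. g \<otimes> v = v \<otimes> g}"
  define Z where "Z = {z \<in> carrier G. \<forall>g\<in>Cv. z \<otimes> g = g \<otimes> z}"
  have Z: "subgroup Z G" unfolding Z_def by (rule subgroup_centralizer) (auto simp: Cv_def)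
  have vZ: "v \<in> Z" "Z \<subseteq> Cv" using v by (auto simp: Z_def Cv_def)
  have Zx: "z \<otimes> g = g \<otimes> z" if "z \<in> Z" "g \<in> Cv" for z g using that by (auto simp: Z_def)
  have xy: "x \<in> Cv" "y \<in> Cv" using x y by (auto simp: Cv_def)
  obtain e where e: "axis_edge v e" using axis_edge_exists[OF v nofix] by blast
  have eE: "e \<in> E" using e by (simp add: axis_edge_def)
  obtain m :: nat and z where m: "0 < m" "z \<in> Z" "act (x [^] m) e = act z e"
    using power_acts_as_axis_symmetry[OF v x e Z vZ(1) Zx] xy by blast
  obtain n :: nat and w where n: "0 < n" "w \<in> Z" "act (y [^] n) e = act w e"
    using power_acts_as_axis_symmetry[OF v y e Z vZ(1) Zx] xy by blast
  have c: "z \<in> carrier G" "w \<in> carrier G" "x [^] m \<in> carrier G" "y [^] n \<in> carrier G"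
    using m n x y by (auto simp: Z_def)
  have CvP: "g [^] k \<in> Cv" if "g \<in> Cv" for g and k :: nat
    using that v by (auto simp: Cv_def group_commutes_pow)
  let ?a = "x [^] m" and ?b = "y [^] n"
  have comm: "z \<otimes> ?a = ?a \<otimes> z" "z \<otimes> ?b = ?b \<otimes> z" "w \<otimes> ?a = ?a \<otimes> w" "w \<otimes> ?b = ?b \<otimes> w"
    "z \<otimes> w = w \<otimes> z"
    using Zx[OF m(2) CvP[OF xy(1)]] Zx[OF m(2) CvP[OF xy(2)]] Zx[OF n(2) CvP[OF xy(1)]]
      Zx[OF n(2) CvP[OF xy(2)]] Zx[OF m(2)] n(2) vZ(2) by auto
  have "act (inv z \<otimes> ?a) e = e" "act (inv w \<otimes> ?b) e = e"
    using m n c eE by (simp_all add: act_mult act_inv)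
  then have eq: "(inv z \<otimes> ?a) \<otimes> (inv w \<otimes> ?b) = (inv w \<otimes> ?b) \<otimes> (inv z \<otimes> ?a)"
    using stabilizer_commutes[OF _ _ _ _ eE] c by simp
  have sub: "subgroup {g \<in> carrier G. \<forall>h\<in>A. g \<otimes> h = h \<otimes> g} G" if "A \<subseteq> carrier G" for A
    using subgroup_centralizer[OF that] .
  \<comment> \<open>\<open>c\<close> and \<open>d\<close> will be the inverses of \<open>z\<close> and \<open>w\<close>; they cancel from \<open>eq\<close>\<close>
  have cc: "a \<otimes> b = b \<otimes> a"
    if ab: "a \<in> carrier G" "b \<in> carrier G" "c \<in> carrier G" "d \<in> carrier G"
      "c \<otimes> a = a \<otimes> c" "c \<otimes> b = b \<otimes> c" "d \<otimes> a = a \<otimes> d" "d \<otimes> b = b \<otimes> d" "c \<otimes> d = d \<otimes> c"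
      "(c \<otimes> a) \<otimes> (d \<otimes> b) = (d \<otimes> b) \<otimes> (c \<otimes> a)" for a b c d
  proof -
    have "(c \<otimes> d) \<otimes> (a \<otimes> b) = (c \<otimes> a) \<otimes> (d \<otimes> b)" using ab by (metis m_assoc m_closed)
    moreover have "(c \<otimes> d) \<otimes> (b \<otimes> a) = (d \<otimes> b) \<otimes> (c \<otimes> a)" using ab by (metis m_assoc m_closed)
    ultimately have "(c \<otimes> d) \<otimes> (a \<otimes> b) = (c \<otimes> d) \<otimes> (b \<otimes> a)" using ab(10) by simp
    then show ?thesis using ab(1-4) by simp
  qed
  have inv_comm: "inv a \<otimes> b = b \<otimes> inv a" if "a \<in> carrier G" "b \<in> carrier G" "a \<otimes> b = b \<otimes> a" for a b
    using subgroup.m_inv_closed[OF sub[of "{b}"], of a] that by simp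
  have "inv z \<otimes> inv w = inv w \<otimes> inv z" using comm(5) c by (metis inv_mult_group)
  then have "?a \<otimes> ?b = ?b \<otimes> ?a"
    using cc[OF c(3,4) inv_closed[OF c(1)] inv_closed[OF c(2)] inv_comm[OF c(1,3) comm(1)]
      inv_comm[OF c(1,4) comm(2)] inv_comm[OF c(2,3) comm(3)] inv_comm[OF c(2,4) comm(4)] _ eq] by blast
  then show ?thesis using m n by blast
qed

text \<open>
  If a generator \<open>v\<close> had no fixed vertex, then its neighbours would have commuting powers and hence be
  pairwise adjacent; they would separate \<open>v\<close> from the rest of the graph. So every generator has fixed
  vertices, and adjacent generators have a common one. An edge \<open>e\<close> of the tree then sorts the
  generators: those that fix \<open>e\<close> commute and form a clique \<open>K\<close>, the others have all their fixed vertices on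
  one side of \<open>e\<close>, and adjacent ones on the same side. Without a clique cut, one of the sides contains no
  generator. Moving along such an edge towards the other side brings the vertex closer to the fixed
  vertices of all generators outside \<open>K\<close>; thus a vertex with the least total distance to the sets of
  fixed vertices must belong to all of them.
\<close>
theorem global_fixed_vertex:
  assumes X: "finite X" and gen: "\<And>x. x \<in> X \<Longrightarrow> gen x \<in> carrier G"
    and generates: "\<And>H. subgroup H G \<Longrightarrow> gen ` X \<subseteq> H \<Longrightarrow> carrier G \<subseteq> H"
    and R_sym: "\<And>x y. R x y \<Longrightarrow> R y x"
    and R_comm: "\<And>x y. x \<in> X \<Longrightarrow> y \<in> X \<Longrightarrow> R x y \<Longrightarrow> gen x \<otimes> gen y = gen y \<otimes> gen x"
    and R_free: "\<And>x y (m::nat) (n::nat). x \<in> X \<Longrightarrow> y \<in> X \<Longrightarrow> x \<noteq> y \<Longrightarrow> \<not> R x y \<Longrightarrow> 0 < m \<Longrightarrow> 0 < n \<Longrightarrow>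
      gen x [^] m \<otimes> gen y [^] n \<noteq> gen y [^] n \<otimes> gen x [^] m"
    and irrefl: "\<And>x. \<not> R x x"
    and no_cut: "\<And>K S T. \<not> clique_cut X R K S T"
    and incomplete: "x0 \<in> X" "y0 \<in> X" "x0 \<noteq> y0" "\<not> R x0 y0"
  shows "\<exists>p\<in>V. \<forall>g\<in>carrier G. mv g p = p"
proof -
  have elliptic: "Fix (gen v) \<noteq> {}" if v: "v \<in> X" for v
  proof
    assume nofix: "Fix (gen v) = {}"
    let ?L = "{x \<in> X. R v x}"
    have complete: "R x y" if "x \<in> ?L" "y \<in> ?L" "x \<noteq> y" for x y
      using hyperbolic_centralizer_powers[OF gen[OF v] nofix, of "gen x" "gen y"] that gen v
        R_comm[of v x] R_comm[of v y] R_free[of x y] by fastforce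
    have "X - ?L - {v} \<noteq> {}"
    proof
      assume "X - ?L - {v} = {}"
      then have "R v x" if "x \<in> X" "x \<noteq> v" for x using that by blast
      then show False using incomplete complete R_sym by (metis (mono_tags, lifting) mem_Collect_eq)
    qed
    then have "clique_cut X R ?L {v} (X - ?L - {v})"
      unfolding clique_cut_def
    proof (intro conjI ballI impI)
      show "R x y" if "x \<in> ?L" "y \<in> ?L" "x \<noteq> y" for x y using complete that .
    qed (use v irrefl in auto)
    then show False using no_cut by blast
  qed
  \<comment> \<open>the distance from \<open>p\<close> to the set of fixed vertices of \<open>u\<close>\<close>
  define d where "d u p = (LEAST n. \<exists>q\<in>Fix u. card (sep p q) = n)" for u p
  have d_attained: "\<exists>q\<in>Fix (gen x). card (sep p q) = d (gen x) p" if "x \<in> X" for x p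
    unfolding d_def by (rule LeastI_ex) (use elliptic[OF that] in blast)
  have d_le: "d u p \<le> card (sep p q)" if "q \<in> Fix u" for u p q
    unfolding d_def by (rule Least_le) (use that in blast)
  have "{} \<in> V" using mv_V_base(1)[of \<one>] mv_one by simp
  then obtain p where p: "p \<in> V"
    and min: "\<And>q. q \<in> V \<Longrightarrow> (\<Sum>x\<in>X. d (gen x) p) \<le> (\<Sum>x\<in>X. d (gen x) q)"
    using ex_has_least_nat[of "\<lambda>p. p \<in> V" _ "\<lambda>p. \<Sum>x\<in>X. d (gen x) p"] by blast
  have "mv (gen v) p = p" if v: "v \<in> X" for v
  proof (rule ccontr)
    assume moved: "mv (gen v) p \<noteq> p"
    obtain q0 where q0: "q0 \<in> Fix (gen v)" using elliptic[OF v] by blast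
    have q0V: "q0 \<in> V" using q0 by (simp add: Fix_def)
    have "p \<noteq> q0" using q0 moved by (auto simp: Fix_def)
    then obtain e p' where e: "adj e p p'" "e \<in> sep p q0" using first_edge[OF p q0V] by blast
    have eE: "e \<in> E" and p': "p' \<in> V" using e adj_closed by blast+
    \<comment> \<open>\<open>T\<close> collects the generators with a fixed vertex on the side of \<open>p\<close>; \<open>v\<close> is on the other side\<close>
    define K where "K = {x \<in> X. act (gen x) e = e}"
    define T where "T = {x \<in> X - K. \<exists>q\<in>Fix (gen x). e \<notin> sep p q}"
    define S where "S = X - K - T"
    have one_side: "e \<notin> sep q r" if "x \<in> X - K" "q \<in> Fix (gen x)" "r \<in> Fix (gen x)" for x q r
      using fix_convex[of "gen x" q r e] that gen by (auto simp: K_def)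
    have "v \<notin> K" using adj_fixed[of "gen v" e p p'] gen v moved e by (auto simp: K_def)
    moreover have "v \<notin> T"
    proof
      assume "v \<in> T"
      then obtain q where "q \<in> Fix (gen v)" "e \<notin> sep p q" unfolding T_def by blast
      then have "e \<in> sep q q0" using e(2) unfolding mem_sep by blast
      then show False using one_side \<open>v \<in> T\<close> \<open>q \<in> _\<close> q0 by (auto simp: T_def)
    qed
    ultimately have vS: "v \<in> S" using v by (simp add: S_def)
    have "\<not> R s t" if sS: "s \<in> S" and tT: "t \<in> T" for s t
    proof
      assume "R s t"
      have st: "s \<in> X" "t \<in> X" "s \<in> X - K" "t \<in> X - K" "s \<notin> T" using sS tT by (auto simp: S_def T_def)
      then obtain r where r: "r \<in> Fix (gen s)" "r \<in> Fix (gen t)"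
        using commuting_fix[of "gen s" "gen t"] gen elliptic R_comm \<open>R s t\<close> by blast
      obtain q where q: "q \<in> Fix (gen t)" "e \<notin> sep p q" using tT unfolding T_def by blast
      have "e \<in> sep p r" using r(1) st unfolding T_def by blast
      then have "e \<in> sep q r" using q unfolding mem_sep by blast
      then show False using one_side st q r by blast
    qed
    moreover have "R x y" if "x \<in> K" "y \<in> K" "x \<noteq> y" for x y
    proof (rule ccontr)
      have xy: "x \<in> X" "y \<in> X" using that by (auto simp: K_def)
      assume "\<not> R x y"
      then have "gen x \<otimes> gen y \<noteq> gen y \<otimes> gen x"
        using R_free[of x y 1 1] xy that(3) gen by simp
      then show False using stabilizer_commutes[OF _ _ _ _ eE] that gen by (auto simp: K_def)
    qed
    moreover have "K \<union> S \<union> T = X" "K \<inter> S = {}" "K \<inter> T = {}" "S \<inter> T = {}"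
      unfolding S_def T_def K_def by blast+
    ultimately have "clique_cut X R K S T" if "T \<noteq> {}"
      using that vS unfolding clique_cut_def by blast
    then have T: "T = {}" using no_cut by blast
    have less: "d (gen x) p' < d (gen x) p" if x: "x \<in> X" "x \<notin> K" for x
    proof -
      obtain q where q: "q \<in> Fix (gen x)" "card (sep p q) = d (gen x) p" using d_attained[OF x(1)] by blast
      have "e \<in> sep p q" using T x q by (auto simp: T_def)
      moreover have "q \<in> V" using q by (simp add: Fix_def)
      ultimately have "card (sep p q) = Suc (card (sep p' q))" using card_sep_adj e by blast
      then show ?thesis using d_le[OF q(1), of p'] q(2) by simp
    qed
    have "d (gen x) p' \<le> d (gen x) p" if x: "x \<in> X" for x
    proof (cases "x \<in> K")
      case True
      then have "p' \<in> Fix (gen x)"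
        using adj_fixed[OF gen[OF x] _ adj_sym[OF e(1)]] p' by (simp add: Fix_def K_def)
      then show ?thesis using d_le[of p' "gen x" p'] by simp
    next
      case False
      then show ?thesis using less[OF x] by simp
    qed
    then have "(\<Sum>x\<in>X. d (gen x) p') < (\<Sum>x\<in>X. d (gen x) p)"
      using X v less[OF v \<open>v \<notin> K\<close>] by (intro sum_strict_mono_ex1) auto
    then show False using min[OF p'] by simp
  qed
  moreover have "subgroup {g \<in> carrier G. mv g p = p} G"
  proof (rule subgroupI)
    show "{g \<in> carrier G. mv g p = p} \<noteq> {}" using mv_one_V[OF p] by blast
  next
    fix a assume "a \<in> {g \<in> carrier G. mv g p = p}"
    then show "inv a \<in> {g \<in> carrier G. mv g p = p}" using mv_inv_V(1)[of a p] p by simp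
  next
    fix a b assume "a \<in> {g \<in> carrier G. mv g p = p}" "b \<in> {g \<in> carrier G. mv g p = p}"
    then show "a \<otimes> b \<in> {g \<in> carrier G. mv g p = p}" using mv_mult_V[of a b p] p by simp
  qed auto
  ultimately have "carrier G \<subseteq> {g \<in> carrier G. mv g p = p}"
    using gen by (intro generates) auto
  then show ?thesis using p by blast
qed

end

section \<open>The tree of a splitting\<close>

context cut_action
begin

lemma adj_path_mv:
  assumes g: "g \<in> carrier G" and pq: "(p, q) \<in> {(p, q). \<exists>e. adj e p q}\<^sup>*"
  shows "(mv g p, mv g q) \<in> {(p, q). \<exists>e. adj e p q}\<^sup>*"
  using pq by induction (auto intro: rtrancl_into_rtrancl dest: adj_mv[OF g])

text \<open>
  Connectedness only has to be checked on generators: the elements that move the base vertex within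
  its connected component form a subgroup.
\<close>
lemma tree_actionI:
  assumes generates: "\<And>H. subgroup H G \<Longrightarrow> X \<subseteq> H \<Longrightarrow> carrier G \<subseteq> H" and X: "X \<subseteq> carrier G"
    and path: "\<And>x. x \<in> X \<Longrightarrow> ({}, D x) \<in> {(p, q). \<exists>e. adj e p q}\<^sup>*"
  shows "tree_action G E act e0 D"
proof -
  let ?T = "{(p, q). \<exists>e. adj e p q}"
  have D_mv: "D g = mv g {}" for g by (simp add: mv_def)
  let ?H = "{g \<in> carrier G. ({}, D g) \<in> ?T\<^sup>*}"
  have "subgroup ?H G"
  proof (rule subgroupI)
    show "?H \<noteq> {}" using D_one by auto
  next
    fix a assume a: "a \<in> ?H"
    have "(mv (inv a) {}, mv (inv a) (mv a {})) \<in> ?T\<^sup>*"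
      using a by (intro adj_path_mv) (auto simp: D_mv)
    then have "(D (inv a), {}) \<in> ?T\<^sup>*" using a by (simp add: mv_inv D_mv)
    moreover have "sym ?T" by (auto simp: sym_def intro: adj_sym)
    ultimately show "inv a \<in> ?H" using a by (auto dest: sym_rtrancl symD)
  next
    fix a b assume a: "a \<in> ?H" and b: "b \<in> ?H"
    have "(mv a {}, mv a (mv b {})) \<in> ?T\<^sup>*" using a b by (intro adj_path_mv) (auto simp: D_mv)
    then show "a \<otimes> b \<in> ?H" using a b by (auto simp: mv_mult D_mv intro: rtrancl_trans)
  qed auto
  then have "carrier G \<subseteq> ?H" using X path by (intro generates) auto
  then show ?thesis by unfold_locales blast
qed

lemma fixed_vertex_is_base_vertex:
  assumes p: "p \<in> V" and fixed: "\<And>g. g \<in> carrier G \<Longrightarrow> mv g p = p"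
  shows "(\<forall>g\<in>carrier G. mv g {} = {}) \<or> (\<forall>g\<in>carrier G. mv g {e0} = {e0})"
proof -
  obtain h b where h: "h \<in> carrier G" "b \<in> {{}, {e0}}" "p = mv h b" using p by (auto simp: V_def)
  have bE: "b \<subseteq> E" using h e0 by auto
  have "p = b" using fixed[of "inv h"] h bE by (simp add: mv_inv)
  then show ?thesis using h fixed by auto
qed

end

context group
begin

lemma coset_eq_iff:
  assumes C: "subgroup C G" and g: "g \<in> carrier G"
  shows "g <# C = C \<longleftrightarrow> g \<in> C"
proof
  assume "g <# C = C"
  then show "g \<in> C" using lcos_self[OF g C] by simp
next
  assume gC: "g \<in> C"
  have "g <# C \<subseteq> C" using gC C by (auto simp: l_coset_def subgroup.m_closed)
  moreover have "C \<subseteq> g <# C"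
  proof
    fix c assume c: "c \<in> C"
    have "inv g \<otimes> c \<in> C" using gC c C by (simp add: subgroup.m_closed subgroup.m_inv_closed)
    then show "c \<in> g <# C"
      using subgroup.lcos_module_rev[OF C is_group g] subgroup.mem_carrier[OF C c] by blast
  qed
  ultimately show "g <# C = C" by blast
qed

lemma coset_set_action:
  assumes C: "subgroup C G"
  shows "set_action G ((\<lambda>g. g <# C) ` carrier G) (l_coset G)"
proof unfold_locales
  have sub: "C \<subseteq> carrier G" using subgroup.subset[OF C] .
  note s = lcos_m_assoc[OF sub] lcos_mult_one[OF sub] l_coset_subset_G[OF sub]
  show "g <# e \<in> (\<lambda>g. g <# C) ` carrier G" if "g \<in> carrier G" "e \<in> (\<lambda>g. g <# C) ` carrier G" for g e
    using that by (auto simp: s)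
  show "\<one> <# e = e" if "e \<in> (\<lambda>g. g <# C) ` carrier G" for e
    using that by (auto simp: s)
  show "(g \<otimes> h) <# e = g <# (h <# e)"
    if "g \<in> carrier G" "h \<in> carrier G" "e \<in> (\<lambda>g. g <# C) ` carrier G" for g h e
    using that by (auto simp: s m_assoc)
qed

lemma coset_cut_action:
  assumes C: "subgroup C G"
    and D: "\<And>g. g \<in> carrier G \<Longrightarrow> D g \<subseteq> (\<lambda>g. g <# C) ` carrier G"
      "\<And>g h. g \<in> carrier G \<Longrightarrow> h \<in> carrier G \<Longrightarrow> D (g \<otimes> h) = sep (D g) (l_coset G g ` D h)"
      "\<And>c. c \<in> C \<Longrightarrow> D c = {}"
  shows "cut_action G ((\<lambda>g. g <# C) ` carrier G) (l_coset G) C D"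
proof -
  interpret A: set_action G "(\<lambda>g. g <# C) ` carrier G" "l_coset G" by (rule coset_set_action[OF C])
  show ?thesis
  proof unfold_locales
    show "C \<in> (\<lambda>g. g <# C) ` carrier G"
      using coset_eq_iff[OF C one_closed] subgroup.one_closed[OF C] by (metis image_eqI one_closed)
    show "D g = {}" if "g \<in> carrier G" "g <# C = C" for g
      using that D(3) coset_eq_iff[OF C] by blast
  qed (use D in auto)
qed

text \<open>
  The edges of the Bass-Serre tree of a splitting over \<open>C\<close> are the left cosets of \<open>C\<close>.
\<close>
definition acts_on_tree_without_fixed_vertex :: "'a set \<Rightarrow> bool" where
  "acts_on_tree_without_fixed_vertex C \<longleftrightarrow>
    (\<exists>D. tree_action G ((\<lambda>g. g <# C) ` carrier G) (l_coset G) C D \<and>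
      (\<forall>p\<in>cut_action.V G (l_coset G) C D. \<exists>g\<in>carrier G. cut_action.mv (l_coset G) D g p \<noteq> p))"

text \<open>
  In the Bass-Serre tree, \<open>A\<close> fixes the base vertex and \<open>B\<close> fixes the other end of the edge \<open>C\<close>. The path
  from the base vertex to its image under \<open>b\<close> therefore consists of the edges \<open>C\<close> and \<open>b C\<close>. This
  prescribes the derivation on \<open>A\<close> and \<open>B\<close>; the two prescriptions agree on \<open>C\<close>. A fixed vertex would be
  one of the ends of \<open>C\<close>, and its being fixed would force \<open>B = C\<close> or \<open>A = C\<close>.
\<close>
lemma amalgamated_product_acts_on_tree:
  assumes am: "is_amalgamated_product G A B C" and ne: "C \<noteq> A" "C \<noteq> B"
  shows "acts_on_tree_without_fixed_vertex C"
proof -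
  define S where "S = amalg_gens (G\<lparr>carrier := A\<rparr>) (G\<lparr>carrier := B\<rparr>)"
  define R where "R = amalg_rels (G\<lparr>carrier := A\<rparr>) (G\<lparr>carrier := B\<rparr>) C (\<lambda>c. c) (\<lambda>c. c)"
  from am obtain \<phi> where sub: "subgroup A G" "subgroup B G" "subgroup C G" "C \<subseteq> A" "C \<subseteq> B"
    and \<phi>: "\<phi> \<in> iso (presented_group S R) G"
    and \<phi>A: "\<And>a. a \<in> A \<Longrightarrow> \<phi> (pres_gen S R (Inl a)) = a"
    and \<phi>B: "\<And>b. b \<in> B \<Longrightarrow> \<phi> (pres_gen S R (Inr b)) = b"
    unfolding is_amalgamated_product_def Let_def S_def R_def by blast
  let ?E = "(\<lambda>g. g <# C) ` carrier G"
  interpret set_action G ?E "l_coset G" by (rule coset_set_action[OF sub(3)])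
  interpret M: group semidirect by (rule group_semidirect)
  have Ac: "a \<in> carrier G" if "a \<in> A" for a using subgroup.mem_carrier[OF sub(1) that] .
  have Bc: "b \<in> carrier G" if "b \<in> B" for b using subgroup.mem_carrier[OF sub(2) that] .
  have Cc: "C \<subseteq> carrier G" using subgroup.subset[OF sub(3)] .
  have S_eq: "S = Inl ` A \<union> Inr ` B" by (auto simp: S_def amalg_gens_def)
  have C_E: "C \<in> ?E" using coset_eq_iff[OF sub(3) one_closed] subgroup.one_closed[OF sub(3)]
    by (metis image_eqI one_closed)
  have coset_C: "c <# C = C" if "c \<in> C" for c using coset_eq_iff[OF sub(3)] that Cc by blast
  define d :: "'a + 'a \<Rightarrow> 'a set set" where "d = case_sum (\<lambda>a. {}) (\<lambda>b. sep {b <# C} {C})"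
  define s where "s = (\<lambda>x. (d x, \<phi> (pres_gen S R x)))"
  have dE: "d x \<subseteq> ?E" if "x \<in> S" for x
    using that C_E Bc by (auto simp: S_eq d_def sep_def)
  have sl: "s (Inl a) = ({}, a)" if "a \<in> A" for a using that \<phi>A by (simp add: s_def d_def)
  have sr: "s (Inr b) = (sep {b <# C} {C}, b)" if "b \<in> B" for b using that \<phi>B by (simp add: s_def d_def)
  have sl_closed: "s (Inl a) \<in> carrier semidirect" if "a \<in> A" for a
    using that Ac by (simp add: sl semidirect_def)
  have sr_closed: "s (Inr b) \<in> carrier semidirect" if "b \<in> B" for b
    using that Bc dE[of "Inr b"] by (simp add: sr semidirect_def S_eq d_def)
  have "word_val semidirect s r = \<one>\<^bsub>semidirect\<^esub>" if r: "r \<in> R" for r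
  proof -
    consider (A) "r \<in> mult_table Inl (G\<lparr>carrier := A\<rparr>)" | (B) "r \<in> mult_table Inr (G\<lparr>carrier := B\<rparr>)"
      | (C) c where "c \<in> C" "r = [(Inl c, True), (Inr c, False)]"
      using r by (auto simp: R_def amalg_rels_def)
    then show ?thesis
    proof cases
      case A
      have "(\<lambda>a. s (Inl a)) \<in> hom (G\<lparr>carrier := A\<rparr>) semidirect"
        using sl_closed sub(1) by (auto intro!: homI simp: sl semidirect_def subgroup.m_closed)
      then show ?thesis
        using M.word_val_mult_table[OF subgroup.subgroup_is_group[OF sub(1) is_group] _ A] by blast
    next
      case B
      have "s (Inr (x \<otimes> y)) = s (Inr x) \<otimes>\<^bsub>semidirect\<^esub> s (Inr y)" if xy: "x \<in> B" "y \<in> B" for x y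
      proof -
        have "l_coset G x ` sep {y <# C} {C} = sep {(x \<otimes> y) <# C} {x <# C}"
          using image_sep[of x "{y <# C}" "{C}"] xy Bc C_E by (simp add: lcos_m_assoc[OF Cc])
        moreover have "sep (sep {x <# C} {C}) (sep {(x \<otimes> y) <# C} {x <# C}) = sep {(x \<otimes> y) <# C} {C}"
          by (auto simp: mem_sep)
        ultimately show ?thesis
          using xy sub(2) by (simp add: sr semidirect_def subgroup.m_closed)
      qed
      then have "(\<lambda>b. s (Inr b)) \<in> hom (G\<lparr>carrier := B\<rparr>) semidirect"
        using sr_closed by (intro homI) auto
      then show ?thesis
        using M.word_val_mult_table[OF subgroup.subgroup_is_group[OF sub(2) is_group] _ B] by blast
    next
      case C
      then have "c \<in> A" "c \<in> B" using sub by auto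
      then have "s (Inl c) = s (Inr c)" using C by (simp add: sl sr coset_C)
      then show ?thesis using C sr_closed[OF \<open>c \<in> B\<close>] by (simp add: letter_val_def)
    qed
  qed
  then have rel: "word_val semidirect (\<lambda>x. (d x, \<phi> (pres_gen S R x))) r = \<one>\<^bsub>semidirect\<^esub>"
    if "r \<in> R \<inter> words S" for r
    using that unfolding s_def by simp
  obtain D where D: "\<And>g. g \<in> carrier G \<Longrightarrow> D g \<subseteq> ?E"
    "\<And>g h. g \<in> carrier G \<Longrightarrow> h \<in> carrier G \<Longrightarrow> D (g \<otimes> h) = sep (D g) (l_coset G g ` D h)"
    and Dx: "\<And>x. x \<in> S \<Longrightarrow> D (\<phi> (pres_gen S R x)) = d x"
    using derivation_of_presentation[OF \<phi> dE rel] by blast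
  have DA: "D a = {}" if "a \<in> A" for a using Dx[of "Inl a"] that \<phi>A by (simp add: S_eq d_def)
  have DB: "D b = sep {b <# C} {C}" if "b \<in> B" for b using Dx[of "Inr b"] that \<phi>B by (simp add: S_eq d_def)
  interpret cut_action G ?E "l_coset G" C D
    by (rule coset_cut_action[OF sub(3) D]) (use DA sub in auto)
  have mv_B: "mv b {C} = {C}" if "b \<in> B" for b
    using DB[OF that] by (auto simp: mv_def mem_sep)
  have "tree_action G ?E (l_coset G) C D"
  proof (rule tree_actionI[of "A \<union> B"])
    show "carrier G \<subseteq> H" if "subgroup H G" "A \<union> B \<subseteq> H" for H
      by (rule iso_presented_generates[OF is_group \<phi> that(1)])
        (use that(2) \<phi>A \<phi>B in \<open>auto simp: S_eq\<close>)
    show "A \<union> B \<subseteq> carrier G" using Ac Bc by blast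
    fix x assume "x \<in> A \<union> B"
    then show "({}, D x) \<in> {(p, q). \<exists>e. adj e p q}\<^sup>*"
    proof
      assume "x \<in> A" then show ?thesis using DA by simp
    next
      assume x: "x \<in> B"
      have "adj (\<one> <# C) {} {C}"
        unfolding adj_def by (intro bexI[of _ \<one>]) (auto simp: mv_one C_E)
      moreover have "adj (x <# C) {C} (D x)"
        unfolding adj_def using mv_B[OF x] Bc[OF x] by (intro bexI[of _ x]) (auto simp: mv_def)
      ultimately have "({}, {C}) \<in> {(p, q). \<exists>e. adj e p q}" "({C}, D x) \<in> {(p, q). \<exists>e. adj e p q}"
        by blast+
      then show ?thesis by (meson converse_rtrancl_into_rtrancl r_into_rtrancl)
    qed
  qed
  moreover have "\<exists>g\<in>carrier G. mv g p \<noteq> p" if p: "p \<in> V" for p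
  proof (rule ccontr)
    assume "\<not> ?thesis"
    then consider "\<forall>g\<in>carrier G. mv g {} = {}" | "\<forall>g\<in>carrier G. mv g {C} = {C}"
      using fixed_vertex_is_base_vertex[OF p] by blast
    then show False
    proof cases
      case 1
      have "b <# C = C" if "b \<in> B" for b
      proof -
        have "sep {b <# C} {C} = {}" using 1 Bc[OF that] DB[OF that] by (simp add: mv_def)
        then show ?thesis unfolding sep_eq_empty by simp
      qed
      then have "B \<subseteq> C" using coset_eq_iff[OF sub(3)] Bc by blast
      then show False using ne sub by blast
    next
      case 2
      have "a <# C = C" if "a \<in> A" for a
      proof -
        have "{a <# C} = {C}" using bspec[OF 2 Ac[OF that]] DA[OF that] by (simp add: mv_def)
        then show ?thesis by simp
      qed
      then have "A \<subseteq> C" using coset_eq_iff[OF sub(3)] Ac by blast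
      then show False using ne sub by blast
    qed
  qed
  ultimately show ?thesis unfolding acts_on_tree_without_fixed_vertex_def by blast
qed

text \<open>
  Here \<open>A\<close> fixes the base vertex, and the single edge \<open>t C\<close> joins it to its image under the stable
  letter \<open>t\<close>. The relation between \<open>t\<close>, \<open>c\<close> and \<open>\<theta> c\<close> is respected because \<open>\<theta> c\<close> fixes the coset \<open>t C\<close>.
  The element \<open>t\<close> moves both ends of \<open>C\<close>, so there is no vertex that is fixed by \<open>G\<close>.
\<close>
lemma hnn_extension_acts_on_tree:
  assumes hnn: "is_hnn_extension G A C"
  shows "acts_on_tree_without_fixed_vertex C"
proof -
  from hnn obtain \<theta> where sub: "subgroup A G" "subgroup C G" "C \<subseteq> A"
    and \<theta>: "\<theta> \<in> mon (G\<lparr>carrier := C\<rparr>) (G\<lparr>carrier := A\<rparr>)"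
    and ex: "let S = hnn_gens (G\<lparr>carrier := A\<rparr>); R = hnn_rels (G\<lparr>carrier := A\<rparr>) C \<theta>
        in \<exists>\<phi> \<in> iso (presented_group S R) G. \<forall>a\<in>A. \<phi> (pres_gen S R (Some a)) = a"
    unfolding is_hnn_extension_def by blast
  define S where "S = hnn_gens (G\<lparr>carrier := A\<rparr>)"
  define R where "R = hnn_rels (G\<lparr>carrier := A\<rparr>) C \<theta>"
  obtain \<phi> where \<phi>: "\<phi> \<in> iso (presented_group S R) G"
    and \<phi>A: "\<And>a. a \<in> A \<Longrightarrow> \<phi> (pres_gen S R (Some a)) = a"
    using ex unfolding Let_def S_def R_def by blast
  define t where "t = \<phi> (pres_gen S R None)"
  let ?E = "(\<lambda>g. g <# C) ` carrier G"
  interpret set_action G ?E "l_coset G" by (rule coset_set_action[OF sub(2)])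
  interpret M: group semidirect by (rule group_semidirect)
  have Ac: "a \<in> carrier G" if "a \<in> A" for a using subgroup.mem_carrier[OF sub(1) that] .
  have Cc: "C \<subseteq> carrier G" using subgroup.subset[OF sub(2)] .
  have \<theta>A: "\<theta> c \<in> A" if "c \<in> C" for c using \<theta> that by (auto simp: mon_def hom_def)
  have S_eq: "S = insert None (Some ` A)" by (simp add: S_def hnn_gens_def)
  have coset_C: "c <# C = C" if "c \<in> C" for c using coset_eq_iff[OF sub(2)] that Cc by blast
  have \<phi>_closed: "\<phi> (pres_gen S R x) \<in> carrier G" if "x \<in> S" for x
    using \<phi> pres_gen_closed[OF that] by (auto simp: iso_def hom_def)
  have t: "t \<in> carrier G" using \<phi>_closed[of None] by (simp add: t_def S_eq)
  have conj: "t \<otimes> c = \<theta> c \<otimes> t" if c: "c \<in> C" for c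
  proof -
    let ?r = "[(None, True), (Some c, True), (None, False), (Some (\<theta> c), False)]"
    have car: "c \<in> carrier G" "\<theta> c \<in> carrier G" using c Ac \<theta>A sub by auto
    have r: "?r \<in> R \<inter> words S" using c sub \<theta>A by (auto simp: R_def hnn_rels_def S_eq)
    interpret P: group "presented_group S R" by (rule group_presented_group)
    have hom: "\<phi> \<in> hom (presented_group S R) G" using \<phi> by (simp add: iso_def)
    have "word_val G (\<lambda>x. \<phi> (pres_gen S R x)) ?r = \<phi> (word_val (presented_group S R) (pres_gen S R) ?r)"
      using r by (intro P.hom_word_val[OF is_group hom, symmetric, of _ S]) (auto simp: pres_gen_closed)
    also have "\<dots> = \<one>"
      unfolding relator_trivial[OF r] using hom_one[OF hom P.is_group is_group] .
    finally have "t \<otimes> (c \<otimes> (inv t \<otimes> inv (\<theta> c))) = \<one>"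
      using c sub \<phi>A \<theta>A car t by (simp add: letter_val_def t_def[symmetric] subsetD)
    then have "(t \<otimes> c) \<otimes> inv (\<theta> c \<otimes> t) = \<one>" using t car by (simp add: inv_mult_group m_assoc)
    then show ?thesis using t car
      by (metis inv_closed inv_equality inv_inv m_closed)
  qed
  define d :: "'a option \<Rightarrow> 'a set set" where "d = case_option {t <# C} (\<lambda>a. {})"
  define s where "s = (\<lambda>x. (d x, \<phi> (pres_gen S R x)))"
  have dE: "d x \<subseteq> ?E" if "x \<in> S" for x
    using that t by (auto simp: S_eq d_def)
  have ss: "s (Some a) = ({}, a)" if "a \<in> A" for a using that \<phi>A by (simp add: s_def d_def)
  have sn: "s None = ({t <# C}, t)" by (simp add: s_def d_def t_def)
  have s_closed: "s x \<in> carrier semidirect" if "x \<in> S" for x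
    using that dE \<phi>_closed by (simp add: s_def semidirect_def)
  have "word_val semidirect s r = \<one>\<^bsub>semidirect\<^esub>" if r: "r \<in> R" for r
  proof -
    consider (A) "r \<in> mult_table Some (G\<lparr>carrier := A\<rparr>)"
      | (C) c where "c \<in> C" "r = [(None, True), (Some c, True), (None, False), (Some (\<theta> c), False)]"
      using r by (auto simp: R_def hnn_rels_def)
    then show ?thesis
    proof cases
      case A
      have "(\<lambda>a. s (Some a)) \<in> hom (G\<lparr>carrier := A\<rparr>) semidirect"
        using Ac sub(1) by (auto intro!: homI simp: ss semidirect_def subgroup.m_closed)
      then show ?thesis
        using M.word_val_mult_table[OF subgroup.subgroup_is_group[OF sub(1) is_group] _ A] by blast
    next
      case C
      have c: "c \<in> A" "\<theta> c \<in> A" using C sub \<theta>A by auto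
      have "\<theta> c <# (t <# C) = t <# C"
        using lcos_m_assoc[OF Cc Ac[OF c(2)] t] lcos_m_assoc[OF Cc t Ac[OF c(1)]]
          conj[OF C(1)] coset_C[OF C(1)] by simp
      then have "s None \<otimes>\<^bsub>semidirect\<^esub> s (Some c) = s (Some (\<theta> c)) \<otimes>\<^bsub>semidirect\<^esub> s None"
        using c conj[OF C(1)] by (simp add: ss sn semidirect_def)
      moreover have "s None \<in> carrier semidirect" "s (Some c) \<in> carrier semidirect"
        "s (Some (\<theta> c)) \<in> carrier semidirect"
        using c s_closed by (auto simp: S_eq)
      ultimately have "s None \<otimes>\<^bsub>semidirect\<^esub> s (Some c) \<otimes>\<^bsub>semidirect\<^esub>
          inv\<^bsub>semidirect\<^esub> (s (Some (\<theta> c)) \<otimes>\<^bsub>semidirect\<^esub> s None) = \<one>\<^bsub>semidirect\<^esub>"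
        by simp
      then show ?thesis using C(2) \<open>s None \<in> _\<close> \<open>s (Some c) \<in> _\<close> \<open>s (Some (\<theta> c)) \<in> _\<close>
        by (simp add: letter_val_def M.inv_mult_group M.m_assoc)
    qed
  qed
  then have rel: "word_val semidirect (\<lambda>x. (d x, \<phi> (pres_gen S R x))) r = \<one>\<^bsub>semidirect\<^esub>"
    if "r \<in> R \<inter> words S" for r
    using that unfolding s_def by simp
  obtain D where D: "\<And>g. g \<in> carrier G \<Longrightarrow> D g \<subseteq> ?E"
    "\<And>g h. g \<in> carrier G \<Longrightarrow> h \<in> carrier G \<Longrightarrow> D (g \<otimes> h) = sep (D g) (l_coset G g ` D h)"
    and Dx: "\<And>x. x \<in> S \<Longrightarrow> D (\<phi> (pres_gen S R x)) = d x"
    using derivation_of_presentation[OF \<phi> dE rel] by blast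
  have DA: "D a = {}" if "a \<in> A" for a using Dx[of "Some a"] that \<phi>A by (simp add: S_eq d_def)
  have Dt: "D t = {t <# C}" using Dx[of None] by (simp add: S_eq d_def t_def)
  interpret cut_action G ?E "l_coset G" C D
    by (rule coset_cut_action[OF sub(2) D]) (use DA sub in auto)
  have mv_t: "mv t {} = {t <# C}" "mv t {C} = {}" using Dt by (auto simp: mv_def)
  have "tree_action G ?E (l_coset G) C D"
  proof (rule tree_actionI[of "insert t A"])
    show "carrier G \<subseteq> H" if "subgroup H G" "insert t A \<subseteq> H" for H
      by (rule iso_presented_generates[OF is_group \<phi> that(1)])
        (use that(2) \<phi>A in \<open>auto simp: S_eq t_def\<close>)
    show "insert t A \<subseteq> carrier G" using Ac t by blast
    fix x assume "x \<in> insert t A"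
    then consider "x = t" | "x \<in> A" by blast
    then show "({}, D x) \<in> {(p, q). \<exists>e. adj e p q}\<^sup>*"
    proof cases
      case 1
      have "adj (t <# C) {} (D t)"
        unfolding adj_def using mv_t t Dt by (intro bexI[of _ t]) auto
      then show ?thesis using 1 by blast
    qed (simp add: DA)
  qed
  moreover have "\<exists>g\<in>carrier G. mv g p \<noteq> p" if p: "p \<in> V" for p
    using fixed_vertex_is_base_vertex[OF p] mv_t t by force
  ultimately show ?thesis unfolding acts_on_tree_without_fixed_vertex_def by blast
qed

lemma splitting_acts_on_tree:
  assumes "splits_over_abelian G"
  obtains C D where "abelian_tree_action G ((\<lambda>g. g <# C) ` carrier G) (l_coset G) C D"
    "\<And>p. p \<in> cut_action.V G (l_coset G) C D \<Longrightarrow> \<exists>g\<in>carrier G. cut_action.mv (l_coset G) D g p \<noteq> p"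
proof -
  obtain C where C: "subgroup C G" "comm_group (G\<lparr>carrier := C\<rparr>)" "acts_on_tree_without_fixed_vertex C"
    using assms amalgamated_product_acts_on_tree hnn_extension_acts_on_tree
    unfolding splits_over_abelian_def by blast
  then obtain D where D: "tree_action G ((\<lambda>g. g <# C) ` carrier G) (l_coset G) C D"
    "\<And>p. p \<in> cut_action.V G (l_coset G) C D \<Longrightarrow> \<exists>g\<in>carrier G. cut_action.mv (l_coset G) D g p \<noteq> p"
    unfolding acts_on_tree_without_fixed_vertex_def by blast
  interpret tree_action G "(\<lambda>g. g <# C) ` carrier G" "l_coset G" C D by (rule D(1))
  interpret C: comm_group "G\<lparr>carrier := C\<rparr>" by (rule C(2))
  have "abelian_tree_action G ((\<lambda>g. g <# C) ` carrier G) (l_coset G) C D"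
  proof unfold_locales
    fix g h assume "g \<in> carrier G" "h \<in> carrier G" "g <# C = C" "h <# C = C"
    then have "g \<in> C" "h \<in> C" using coset_eq_iff[OF C(1)] by blast+
    then show "g \<otimes> h = h \<otimes> g" using C.m_comm[of g h] by simp
  qed
  then show ?thesis using that D(2) by blast
qed

end

section \<open>Right-angled Artin groups\<close>

lemma subgroup_equalizer:
  assumes G: "group G" and H: "group H" and f: "f \<in> hom G H" and g: "g \<in> hom G H"
  shows "subgroup {x \<in> carrier G. f x = g x} G"
proof -
  interpret f: group_hom G H f using G H f by (simp add: group_hom_def group_hom_axioms_def)
  interpret g: group_hom G H g using G H g by (simp add: group_hom_def group_hom_axioms_def)
  show ?thesis by (rule group.subgroupI[OF G]) (auto intro: exI[of _ "\<one>\<^bsub>G\<^esub>"])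
qed

lemma (in group) hom_eq_on_generate:
  assumes H: "group H" and Y: "Y \<subseteq> carrier G"
    and f: "f \<in> hom (G\<lparr>carrier := generate G Y\<rparr>) H" and g: "g \<in> hom (G\<lparr>carrier := generate G Y\<rparr>) H"
    and eq: "\<And>y. y \<in> Y \<Longrightarrow> f y = g y" and x: "x \<in> generate G Y"
  shows "f x = g x"
proof -
  let ?A = "G\<lparr>carrier := generate G Y\<rparr>"
  have sub: "subgroup (generate G Y) G" by (rule generate_is_subgroup[OF Y])
  then have "group ?A" by (rule subgroup_imp_group)
  then have "subgroup {x \<in> carrier ?A. f x = g x} ?A" by (rule subgroup_equalizer[OF _ H f g])
  then have "subgroup {x \<in> generate G Y. f x = g x} G"
    using incl_subgroup[OF sub] by simp
  then have "generate G Y \<subseteq> {x \<in> generate G Y. f x = g x}"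
    by (rule generate_subgroup_incl[rotated]) (auto intro: generate.incl eq)
  then show ?thesis using x by blast
qed

text \<open>
  Taking the centralizer twice passes from the generators to the subgroup they generate.
\<close>
lemma (in group) generate_commutes:
  assumes Y: "Y \<subseteq> carrier G" and comm: "\<And>x y. x \<in> Y \<Longrightarrow> y \<in> Y \<Longrightarrow> x \<otimes> y = y \<otimes> x"
    and xy: "x \<in> generate G Y" "y \<in> generate G Y"
  shows "x \<otimes> y = y \<otimes> x"
proof -
  have 1: "generate G Y \<subseteq> {z \<in> carrier G. \<forall>g\<in>Y. z \<otimes> g = g \<otimes> z}"
    using Y comm by (intro generate_subgroup_incl subgroup_centralizer) auto
  have "generate G Y \<subseteq> {z \<in> carrier G. \<forall>g\<in>generate G Y. z \<otimes> g = g \<otimes> z}"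
  proof (rule generate_subgroup_incl[OF _ subgroup_centralizer[OF generate_incl[OF Y]]], rule subsetI)
    fix z assume "z \<in> Y"
    then show "z \<in> {z \<in> carrier G. \<forall>g\<in>generate G Y. z \<otimes> g = g \<otimes> z}"
      using 1 Y by (auto dest!: subsetD[OF 1])
  qed
  then show ?thesis using xy by blast
qed

definition commutator_rels :: "('x \<Rightarrow> 'x \<Rightarrow> bool) \<Rightarrow> 'x word set" where
  "commutator_rels R = {[(u, True), (v, True), (u, False), (v, False)] | u v. R u v}"

lemma (in group) word_val_commutator:
  assumes "s u \<in> carrier G" "s v \<in> carrier G"
  shows "word_val G s [(u, True), (v, True), (u, False), (v, False)] = \<one> \<longleftrightarrow> s u \<otimes> s v = s v \<otimes> s u"
proof -
  have "word_val G s [(u, True), (v, True), (u, False), (v, False)] = (s u \<otimes> s v) \<otimes> inv (s v \<otimes> s u)"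
    using assms by (simp add: letter_val_def m_assoc inv_mult_group)
  also have "\<dots> = \<one> \<longleftrightarrow> s u \<otimes> s v = s v \<otimes> s u"
  proof
    assume "(s u \<otimes> s v) \<otimes> inv (s v \<otimes> s u) = \<one>"
    then show "s u \<otimes> s v = s v \<otimes> s u"
      using assms inv_equality[of "s u \<otimes> s v" "inv (s v \<otimes> s u)"] by (simp add: inv_inv del: inv_mult_group)
  qed (use assms in simp)
  finally show ?thesis .
qed

text \<open>
  The right-angled Artin group of an arbitrary simple graph, given by its adjacency relation.
\<close>
locale raa_group =
  fixes X :: "'x set" and R :: "'x \<Rightarrow> 'x \<Rightarrow> bool" and G
  assumes R_sym: "R x y \<Longrightarrow> R y x" and R_irrefl: "\<not> R x x"
  defines "G \<equiv> presented_group X (commutator_rels R)"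
begin

abbreviation gen :: "'x \<Rightarrow> 'x word set" where
  "gen \<equiv> pres_gen X (commutator_rels R)"

sublocale group G
  unfolding G_def by (rule group_presented_group)

lemma gen_closed [simp]: "x \<in> X \<Longrightarrow> gen x \<in> carrier G"
  unfolding G_def by (rule pres_gen_closed)

lemma gen_commute:
  assumes "u \<in> X" "v \<in> X" "R u v"
  shows "gen u \<otimes>\<^bsub>G\<^esub> gen v = gen v \<otimes>\<^bsub>G\<^esub> gen u"
proof -
  have "[(u, True), (v, True), (u, False), (v, False)] \<in> commutator_rels R \<inter> words X"
    using assms by (auto simp: commutator_rels_def)
  then have "word_val G gen [(u, True), (v, True), (u, False), (v, False)] = \<one>\<^bsub>G\<^esub>"
    unfolding G_def by (rule relator_trivial)
  then show ?thesis using word_val_commutator[of gen u v] assms by (simp del: word_val.simps)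
qed

lemma generates:
  assumes H: "subgroup H G" and gen: "gen ` X \<subseteq> H"
  shows "carrier G \<subseteq> H"
proof
  fix g assume "g \<in> carrier G"
  then obtain w where w: "w \<in> words X" "g = word_val G gen w"
    using presented_group_surj unfolding G_def by blast
  show "g \<in> H" unfolding w(2) by (rule word_val_in_subgroup[OF H _ w(1)]) (use gen in blast)
qed

lemma lift:
  assumes H: "group H" and s: "\<And>x. x \<in> X \<Longrightarrow> s x \<in> carrier H"
    and comm: "\<And>u v. u \<in> X \<Longrightarrow> v \<in> X \<Longrightarrow> R u v \<Longrightarrow> s u \<otimes>\<^bsub>H\<^esub> s v = s v \<otimes>\<^bsub>H\<^esub> s u"
  obtains \<psi> where "\<psi> \<in> hom G H" "\<And>x. x \<in> X \<Longrightarrow> \<psi> (gen x) = s x"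
proof -
  have rel: "word_val H s r = \<one>\<^bsub>H\<^esub>" if r: "r \<in> commutator_rels R \<inter> words X" for r
  proof -
    obtain u v where "r = [(u, True), (v, True), (u, False), (v, False)]" "R u v" "u \<in> X" "v \<in> X"
      using r by (auto simp: commutator_rels_def)
    then show ?thesis using group.word_val_commutator[OF H, of s u v] s comm by (simp del: word_val.simps)
  qed
  have "s \<in> X \<rightarrow> carrier H" using s by blast
  then show ?thesis using group.presented_group_lift[OF H _ rel] that unfolding G_def by blast
qed

end

text \<open>
  Affine maps \<open>x \<mapsto> a x + b\<close> of the real line. Nontrivial powers of the translation by one and of the
  doubling map never commute, so this group detects missing edges of the graph.
\<close>
definition affine_group :: "(real \<times> real) monoid" where
  "affine_group = \<lparr>carrier = {(a, b). a \<noteq> 0},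
     monoid.mult = (\<lambda>(a, b) (c, d). (a * c, a * d + b)), one = (1, 0)\<rparr>"

lemma group_affine_group: "group affine_group"
proof (rule groupI)
  fix x assume "x \<in> carrier affine_group"
  then obtain a b where "x = (a, b)" "a \<noteq> 0" by (auto simp: affine_group_def)
  then show "\<exists>y\<in>carrier affine_group. y \<otimes>\<^bsub>affine_group\<^esub> x = \<one>\<^bsub>affine_group\<^esub>"
    by (intro bexI[of _ "(1 / a, - b / a)"]) (auto simp: affine_group_def)
qed (auto simp: affine_group_def algebra_simps)

lemma affine_translation_pow:
  fixes m :: nat shows "(1, 1) [^]\<^bsub>affine_group\<^esub> m = (1, real m)"
proof -
  interpret group affine_group by (rule group_affine_group)
  show ?thesis by (induction m) (auto simp: affine_group_def)
qed

lemma affine_scaling_pow: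
  fixes n :: nat shows "(2, 0) [^]\<^bsub>affine_group\<^esub> n = (2 ^ n, 0)"
proof -
  interpret group affine_group by (rule group_affine_group)
  show ?thesis by (induction n) (auto simp: affine_group_def)
qed

context raa_group
begin

text \<open>
  Sending \<open>x\<close> to a translation, \<open>y\<close> to the doubling map and the other generators to the identity
  respects the relators precisely because \<open>x\<close> and \<open>y\<close> are not adjacent.
\<close>
lemma powers_not_commute:
  fixes m n :: nat
  assumes xy: "x \<in> X" "y \<in> X" "x \<noteq> y" "\<not> R x y" and mn: "0 < m" "0 < n"
  shows "gen x [^]\<^bsub>G\<^esub> m \<otimes>\<^bsub>G\<^esub> gen y [^]\<^bsub>G\<^esub> n \<noteq> gen y [^]\<^bsub>G\<^esub> n \<otimes>\<^bsub>G\<^esub> gen x [^]\<^bsub>G\<^esub> m"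
proof
  assume eq: "gen x [^]\<^bsub>G\<^esub> m \<otimes>\<^bsub>G\<^esub> gen y [^]\<^bsub>G\<^esub> n = gen y [^]\<^bsub>G\<^esub> n \<otimes>\<^bsub>G\<^esub> gen x [^]\<^bsub>G\<^esub> m"
  interpret A: group affine_group by (rule group_affine_group)
  define s :: "'x \<Rightarrow> real \<times> real" where
    "s z = (if z = x then (1, 1) else if z = y then (2, 0) else (1, 0))" for z
  have "s u \<otimes>\<^bsub>affine_group\<^esub> s v = s v \<otimes>\<^bsub>affine_group\<^esub> s u" if "R u v" for u v
    using that xy R_sym by (auto simp: s_def affine_group_def)
  moreover have "s z \<in> carrier affine_group" for z by (simp add: s_def affine_group_def)
  ultimately obtain \<psi> where \<psi>: "\<psi> \<in> hom G affine_group" "\<And>z. z \<in> X \<Longrightarrow> \<psi> (gen z) = s z"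
    using lift[OF group_affine_group, of s] by blast
  interpret \<psi>: group_hom G affine_group \<psi>
    using \<psi>(1) by (simp add: group_hom_def group_hom_axioms_def is_group A.is_group)
  have "\<psi> (gen x [^]\<^bsub>G\<^esub> m) = (1, real m)" "\<psi> (gen y [^]\<^bsub>G\<^esub> n) = (2 ^ n, 0)"
    using xy by (simp_all add: \<psi>.hom_nat_pow \<psi>(2) s_def affine_translation_pow affine_scaling_pow)
  then have "(1, real m) \<otimes>\<^bsub>affine_group\<^esub> (2 ^ n, 0) = (2 ^ n, 0) \<otimes>\<^bsub>affine_group\<^esub> (1, real m)"
    using xy arg_cong[OF eq, of \<psi>] by simp
  then show False using mn one_less_power[of "2 :: real" n] by (simp add: affine_group_def)
qed

text \<open>
  Sending \<open>v\<close> to a translation and the other generators to the identity kills \<open>K\<close> but not \<open>v\<close>.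
\<close>
lemma gen_notin_generate:
  assumes v: "v \<in> X" "v \<notin> K" and K: "K \<subseteq> X"
  shows "gen v \<notin> generate G (gen ` K)"
proof
  assume gv: "gen v \<in> generate G (gen ` K)"
  interpret A: group affine_group by (rule group_affine_group)
  define s :: "'x \<Rightarrow> real \<times> real" where "s z = (if z = v then (1, 1) else (1, 0))" for z
  have "s u \<otimes>\<^bsub>affine_group\<^esub> s w = s w \<otimes>\<^bsub>affine_group\<^esub> s u" for u w
    by (auto simp: s_def affine_group_def)
  moreover have "s z \<in> carrier affine_group" for z by (simp add: s_def affine_group_def)
  ultimately obtain \<psi> where \<psi>: "\<psi> \<in> hom G affine_group" "\<And>z. z \<in> X \<Longrightarrow> \<psi> (gen z) = s z"
    using lift[OF group_affine_group, of s] by blast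
  interpret \<psi>: group_hom G affine_group \<psi>
    using \<psi>(1) by (simp add: group_hom_def group_hom_axioms_def is_group A.is_group)
  have "subgroup (kernel G affine_group \<psi>) G" by (rule \<psi>.subgroup_kernel)
  moreover have "gen ` K \<subseteq> kernel G affine_group \<psi>"
    using K v \<psi>(2) by (auto simp: kernel_def s_def affine_group_def subset_iff)
  ultimately have "gen v \<in> kernel G affine_group \<psi>" using gv generate_subgroup_incl by blast
  then show False using \<psi>(2)[OF v(1)] by (simp add: kernel_def s_def affine_group_def)
qed

lemma generate_clique_abelian:
  assumes "K \<subseteq> X" "\<And>x y. x \<in> K \<Longrightarrow> y \<in> K \<Longrightarrow> x \<noteq> y \<Longrightarrow> R x y"
    and "g \<in> generate G (gen ` K)" "h \<in> generate G (gen ` K)"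
  shows "g \<otimes>\<^bsub>G\<^esub> h = h \<otimes>\<^bsub>G\<^esub> g"
proof (rule generate_commutes[OF _ _ assms(3,4)])
  show "gen ` K \<subseteq> carrier G" using assms(1) by auto
  fix x y assume "x \<in> gen ` K" "y \<in> gen ` K"
  then obtain a b where "x = gen a" "y = gen b" "a \<in> K" "b \<in> K" by blast
  then show "x \<otimes>\<^bsub>G\<^esub> y = y \<otimes>\<^bsub>G\<^esub> x"
    using gen_commute[of a b] assms(1,2) by (cases "a = b") auto
qed

lemma comm_group_generate_clique:
  assumes "K \<subseteq> X" "\<And>x y. x \<in> K \<Longrightarrow> y \<in> K \<Longrightarrow> x \<noteq> y \<Longrightarrow> R x y"
  shows "comm_group (G\<lparr>carrier := generate G (gen ` K)\<rparr>)"
proof -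
  have "subgroup (generate G (gen ` K)) G" using assms(1) by (intro generate_is_subgroup) auto
  then have "group (G\<lparr>carrier := generate G (gen ` K)\<rparr>)" by (rule subgroup_imp_group)
  then show ?thesis using generate_clique_abelian[OF assms] by (intro group.group_comm_groupI) auto
qed

end

text \<open>
  It suffices that \<open>\<phi>\<close> and \<open>\<psi>\<close> are mutually inverse on generators.
\<close>

lemma presented_group_isoI:
  assumes G: "group G" and \<phi>: "\<phi> \<in> hom (presented_group S Q) G" and \<psi>: "\<psi> \<in> hom G (presented_group S Q)"
    and 1: "\<And>x. x \<in> S \<Longrightarrow> \<psi> (\<phi> (pres_gen S Q x)) = pres_gen S Q x"
    and 2: "\<And>y. y \<in> Y \<Longrightarrow> \<phi> (\<psi> y) = y" and Y: "Y \<subseteq> carrier G"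
    and gen: "\<And>H. subgroup H G \<Longrightarrow> Y \<subseteq> H \<Longrightarrow> carrier G \<subseteq> H"
  shows "\<phi> \<in> iso (presented_group S Q) G"
proof -
  let ?P = "presented_group S Q"
  interpret P: group ?P by (rule group_presented_group)
  have id: "(\<lambda>x. x) \<in> hom G G" by (simp add: hom_def)
  have idP: "(\<lambda>x. x) \<in> hom ?P ?P" by (simp add: hom_def)
  have c1: "\<psi> \<circ> \<phi> \<in> hom ?P ?P" using hom_compose[OF \<phi> \<psi>] .
  have c2: "\<phi> \<circ> \<psi> \<in> hom G G" using hom_compose[OF \<psi> \<phi>] .
  have E1: "subgroup {x \<in> carrier ?P. (\<psi> \<circ> \<phi>) x = x} ?P"
    by (rule subgroup_equalizer[OF P.is_group P.is_group c1 idP])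
  have left: "\<psi> (\<phi> x) = x" if x: "x \<in> carrier ?P" for x
  proof -
    obtain w where w: "w \<in> words S" "x = word_val ?P (pres_gen S Q) w"
      using presented_group_surj[OF x] by blast
    have "x \<in> {x \<in> carrier ?P. (\<psi> \<circ> \<phi>) x = x}"
      unfolding w(2) by (rule P.word_val_in_subgroup[OF E1 _ w(1)]) (use 1 pres_gen_closed in auto)
    then show ?thesis by simp
  qed
  have E2: "subgroup {x \<in> carrier G. (\<phi> \<circ> \<psi>) x = x} G"
    by (rule subgroup_equalizer[OF G G c2 id])
  have "carrier G \<subseteq> {x \<in> carrier G. (\<phi> \<circ> \<psi>) x = x}"
    by (rule gen[OF E2]) (use 2 Y in auto)
  then have right: "\<phi> (\<psi> x) = x" if "x \<in> carrier G" for x using that by auto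
  have "bij_betw \<phi> (carrier ?P) (carrier G)"
    by (rule bij_betwI[of _ _ _ \<psi>]) (use \<phi> \<psi> left right in \<open>auto simp: hom_def\<close>)
  then show ?thesis using \<phi> by (simp add: iso_def)
qed

lemma mult_table_hom:
  assumes A: "group A" and rels: "mult_table \<iota> A \<subseteq> Q" and gens: "\<iota> ` carrier A \<subseteq> S"
  shows "(\<lambda>a. pres_gen S Q (\<iota> a)) \<in> hom A (presented_group S Q)"
proof (rule homI)
  interpret A: group A by (rule A)
  interpret P: group "presented_group S Q" by (rule group_presented_group)
  let ?g = "\<lambda>a. pres_gen S Q (\<iota> a)"
  show c: "?g a \<in> carrier (presented_group S Q)" if "a \<in> carrier A" for a
    using that gens by (intro pres_gen_closed) blast
  fix x y assume xy: "x \<in> carrier A" "y \<in> carrier A"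
  let ?r = "[(\<iota> x, True), (\<iota> y, True), (\<iota> (x \<otimes>\<^bsub>A\<^esub> y), False)]"
  have "?r \<in> Q \<inter> words S" using xy rels gens by (auto simp: mult_table_def subset_iff)
  then have "word_val (presented_group S Q) (pres_gen S Q) ?r = \<one>\<^bsub>presented_group S Q\<^esub>"
    by (rule relator_trivial)
  then have eq: "(?g x \<otimes>\<^bsub>presented_group S Q\<^esub> ?g y) \<otimes>\<^bsub>presented_group S Q\<^esub> inv\<^bsub>presented_group S Q\<^esub> ?g (x \<otimes>\<^bsub>A\<^esub> y) = \<one>\<^bsub>presented_group S Q\<^esub>"
    using c xy by (simp add: letter_val_def P.m_assoc)
  then show "?g (x \<otimes>\<^bsub>A\<^esub> y) = ?g x \<otimes>\<^bsub>presented_group S Q\<^esub> ?g y"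
    using c xy P.inv_equality[OF eq] by simp
qed

section \<open>Splittings of right-angled Artin groups\<close>

context raa_group
begin

abbreviation subgraph_group :: "'x set \<Rightarrow> 'x word set set" where
  "subgraph_group Y \<equiv> generate G (gen ` Y)"

lemma subgraph_group_subgroup: "Y \<subseteq> X \<Longrightarrow> subgroup (subgraph_group Y) G"
  by (intro generate_is_subgroup) auto

lemma gen_in_subgraph_group: "x \<in> Y \<Longrightarrow> gen x \<in> subgraph_group Y"
  by (simp add: generate.incl)

text \<open>
  Every edge of the graph lies in \<open>K \<union> S\<close> or in \<open>K \<union> T\<close>, so the defining relations are those of the
  two parts together with the identification of the common generators in \<open>K\<close>. Formally, \<open>\<phi>\<close> and \<open>\<psi>\<close> come
  from the universal properties of the two presentations.
\<close>
theorem clique_cut_splitting: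
  assumes cut: "clique_cut X R K S T"
  shows "is_amalgamated_product G (subgraph_group (K \<union> S)) (subgraph_group (K \<union> T)) (subgraph_group K)"
proof -
  define A where "A = subgraph_group (K \<union> S)"
  define B where "B = subgraph_group (K \<union> T)"
  define C where "C = subgraph_group K"
  have X: "K \<union> S \<union> T = X" and disj: "S \<inter> T = {}"
    and no_edge: "\<And>s t. s \<in> S \<Longrightarrow> t \<in> T \<Longrightarrow> \<not> R s t"
    using cut by (auto simp: clique_cut_def)
  have sub: "subgroup A G" "subgroup B G" "subgroup C G"
    unfolding A_def B_def C_def by (rule subgraph_group_subgroup, use X in blast)+
  have CA: "C \<subseteq> A" "C \<subseteq> B"
    unfolding A_def B_def C_def by (auto intro!: mono_generate)
  let ?GA = "G\<lparr>carrier := A\<rparr>" and ?GB = "G\<lparr>carrier := B\<rparr>"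
  define S' where "S' = amalg_gens ?GA ?GB"
  define Q where "Q = amalg_rels ?GA ?GB C (\<lambda>c. c) (\<lambda>c. c)"
  let ?P = "presented_group S' Q"
  interpret P: group ?P by (rule group_presented_group)
  have grp: "group ?GA" "group ?GB" using subgroup_imp_group[OF sub(1)] subgroup_imp_group[OF sub(2)] .
  have S'_eq: "S' = Inl ` A \<union> Inr ` B" by (auto simp: S'_def amalg_gens_def)
  note carr = subgroup.mem_carrier[OF sub(1)] subgroup.mem_carrier[OF sub(2)]
  let ?l = "\<lambda>a. pres_gen S' Q (Inl a)" and ?r = "\<lambda>b. pres_gen S' Q (Inr b)"
  have l_hom: "?l \<in> hom ?GA ?P"
    by (rule mult_table_hom[OF grp(1)]) (auto simp: Q_def amalg_rels_def S'_eq)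
  have r_hom: "?r \<in> hom ?GB ?P"
    by (rule mult_table_hom[OF grp(2)]) (auto simp: Q_def amalg_rels_def S'_eq)
  have lr: "?l c = ?r c" if "c \<in> C" for c
  proof -
    have cl: "?l c \<in> carrier ?P" "?r c \<in> carrier ?P"
      using that CA by (auto intro!: pres_gen_closed simp: S'_eq)
    have "[(Inl c, True), (Inr c, False)] \<in> Q \<inter> words S'"
      using that CA by (auto simp: Q_def amalg_rels_def S'_eq)
    then have "word_val ?P (pres_gen S' Q) [(Inl c, True), (Inr c, False)] = \<one>\<^bsub>?P\<^esub>"
      by (rule relator_trivial)
    then have "?l c \<otimes>\<^bsub>?P\<^esub> inv\<^bsub>?P\<^esub> ?r c = \<one>\<^bsub>?P\<^esub>"
      using cl by (simp add: letter_val_def)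
    then show ?thesis using P.inv_equality cl by fastforce
  qed
  obtain \<phi> where \<phi>: "\<phi> \<in> hom ?P G" and \<phi>x: "\<And>x. x \<in> S' \<Longrightarrow> \<phi> (pres_gen S' Q x) = case_sum (\<lambda>a. a) (\<lambda>b. b) x"
  proof (rule presented_group_lift[of "case_sum (\<lambda>a. a) (\<lambda>b. b)" S' Q])
    show "case_sum (\<lambda>a. a) (\<lambda>b. b) \<in> S' \<rightarrow> carrier G" using carr by (auto simp: S'_eq)
    fix r assume "r \<in> Q \<inter> words S'"
    then consider "r \<in> mult_table Inl ?GA" | "r \<in> mult_table Inr ?GB"
      | c where "c \<in> C" "r = [(Inl c, True), (Inr c, False)]"
      by (auto simp: Q_def amalg_rels_def)
    then show "word_val G (case_sum (\<lambda>a. a) (\<lambda>b. b)) r = \<one>\<^bsub>G\<^esub>"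
    proof cases
      case 1
      show ?thesis by (rule word_val_mult_table[OF grp(1) _ 1]) (use carr in \<open>auto simp: hom_def\<close>)
    next
      case 2
      show ?thesis by (rule word_val_mult_table[OF grp(2) _ 2]) (use carr in \<open>auto simp: hom_def\<close>)
    next
      case 3
      then have "c \<in> carrier G" using CA carr by blast
      then show ?thesis using 3 by (simp add: letter_val_def)
    qed
  qed blast
  define s where "s x = (if x \<in> K \<union> S then ?l (gen x) else ?r (gen x))" for x
  have gA: "gen x \<in> A" if "x \<in> K \<union> S" for x using that unfolding A_def by (rule gen_in_subgraph_group)
  have gB: "gen x \<in> B" if "x \<in> K \<union> T" for x using that unfolding B_def by (rule gen_in_subgraph_group)
  have gC: "gen x \<in> C" if "x \<in> K" for x using that unfolding C_def by (rule gen_in_subgraph_group)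
  have s_l: "s x = ?l (gen x)" if "x \<in> K \<union> S" for x using that by (simp add: s_def)
  \<comment> \<open>on \<open>K\<close> the two embeddings agree, so \<open>s\<close> restricts to each of them on its part of the graph\<close>
  have s_r: "s x = ?r (gen x)" if "x \<in> K \<union> T" for x
    using that disj lr gC by (auto simp: s_def)
  have "s x \<in> carrier ?P" if "x \<in> X" for x
  proof (cases "x \<in> K \<union> S")
    case True
    then show ?thesis using gA by (auto simp: s_l S'_eq intro!: pres_gen_closed)
  next
    case False
    then have "x \<in> K \<union> T" using that X by blast
    then show ?thesis using gB by (auto simp: s_r S'_eq intro!: pres_gen_closed)
  qed
  moreover have "s u \<otimes>\<^bsub>?P\<^esub> s v = s v \<otimes>\<^bsub>?P\<^esub> s u" if uv: "u \<in> X" "v \<in> X" "R u v" for u v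
  proof -
    have com: "gen u \<otimes>\<^bsub>G\<^esub> gen v = gen v \<otimes>\<^bsub>G\<^esub> gen u" using gen_commute uv by blast
    have "u \<in> K \<union> S \<and> v \<in> K \<union> S \<or> u \<in> K \<union> T \<and> v \<in> K \<union> T"
      using uv X no_edge R_sym by blast
    then show ?thesis
    proof
      assume a: "u \<in> K \<union> S \<and> v \<in> K \<union> S"
      then have "gen u \<in> A" "gen v \<in> A" using gA by blast+
      then show ?thesis
        using hom_mult[OF l_hom, of "gen u" "gen v"] hom_mult[OF l_hom, of "gen v" "gen u"] com a
        by (simp add: s_l)
    next
      assume a: "u \<in> K \<union> T \<and> v \<in> K \<union> T"
      then have "gen u \<in> B" "gen v \<in> B" using gB by blast+
      then show ?thesis
        using hom_mult[OF r_hom, of "gen u" "gen v"] hom_mult[OF r_hom, of "gen v" "gen u"] com a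
        by (simp add: s_r)
    qed
  qed
  ultimately obtain \<psi> where \<psi>: "\<psi> \<in> hom G ?P" and \<psi>x: "\<And>x. x \<in> X \<Longrightarrow> \<psi> (gen x) = s x"
    using lift[OF P.is_group, of s] by blast
  have \<psi>A: "\<psi> a = ?l a" if "a \<in> A" for a
  proof (rule hom_eq_on_generate[OF P.is_group, of "gen ` (K \<union> S)"])
    show "gen ` (K \<union> S) \<subseteq> carrier G" by (intro image_subsetI gen_closed) (use X in blast)
    show "\<psi> \<in> hom (G\<lparr>carrier := subgraph_group (K \<union> S)\<rparr>) ?P"
      using \<psi> carr unfolding A_def[symmetric] by (auto simp: hom_def)
    show "?l \<in> hom (G\<lparr>carrier := subgraph_group (K \<union> S)\<rparr>) ?P" using l_hom unfolding A_def .
    show "\<psi> y = ?l y" if "y \<in> gen ` (K \<union> S)" for y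
    proof -
      obtain x where x: "x \<in> K \<union> S" "y = gen x" using \<open>y \<in> gen ` (K \<union> S)\<close> by blast
      then have "x \<in> X" using X by blast
      then show ?thesis using x \<psi>x s_l by simp
    qed
  qed (use that A_def in simp)
  have \<psi>B: "\<psi> b = ?r b" if "b \<in> B" for b
  proof (rule hom_eq_on_generate[OF P.is_group, of "gen ` (K \<union> T)"])
    show "gen ` (K \<union> T) \<subseteq> carrier G" by (intro image_subsetI gen_closed) (use X in blast)
    show "\<psi> \<in> hom (G\<lparr>carrier := subgraph_group (K \<union> T)\<rparr>) ?P"
      using \<psi> carr unfolding B_def[symmetric] by (auto simp: hom_def)
    show "?r \<in> hom (G\<lparr>carrier := subgraph_group (K \<union> T)\<rparr>) ?P" using r_hom unfolding B_def .
    show "\<psi> y = ?r y" if "y \<in> gen ` (K \<union> T)" for y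
    proof -
      obtain x where x: "x \<in> K \<union> T" "y = gen x" using \<open>y \<in> gen ` (K \<union> T)\<close> by blast
      then have "x \<in> X" using X by blast
      then show ?thesis using x \<psi>x s_r by simp
    qed
  qed (use that B_def in simp)
  have \<phi>l: "\<phi> (?l a) = a" if "a \<in> A" for a using that \<phi>x[of "Inl a"] by (simp add: S'_eq)
  have \<phi>r: "\<phi> (?r b) = b" if "b \<in> B" for b using that \<phi>x[of "Inr b"] by (simp add: S'_eq)
  have iso: "\<phi> \<in> iso ?P G"
  proof (rule presented_group_isoI[OF is_group \<phi> \<psi>, of "gen ` X"])
    show "\<psi> (\<phi> (pres_gen S' Q x)) = pres_gen S' Q x" if "x \<in> S'" for x
      using that \<phi>l \<phi>r \<psi>A \<psi>B by (auto simp: S'_eq)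
    show "\<phi> (\<psi> y) = y" if y: "y \<in> gen ` X" for y
    proof -
      obtain x where x: "x \<in> X" "y = gen x" using y by blast
      show ?thesis
      proof (cases "x \<in> K \<union> S")
        case True
        then show ?thesis using x \<psi>x s_l \<phi>l gA by simp
      next
        case False
        then have "x \<in> K \<union> T" using x X by blast
        then show ?thesis using x \<psi>x s_r \<phi>r gB by simp
      qed
    qed
  qed (use generates in auto)
  show ?thesis
    unfolding is_amalgamated_product_def Let_def A_def[symmetric] B_def[symmetric]
      C_def[symmetric] S'_def[symmetric] Q_def[symmetric]
    by (intro conjI sub CA bexI[OF _ iso] ballI \<phi>l \<phi>r)
qed

text \<open>
  A free abelian group is an HNN extension of the subgroup generated by all basis elements except \<open>v\<close>,
  with stable letter \<open>v\<close> acting trivially. For a single vertex this is the infinite cyclic group as an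
  HNN extension of the trivial group.
\<close>
theorem complete_graph_splitting:
  assumes v: "v \<in> X" and complete: "\<And>x y. x \<in> X \<Longrightarrow> y \<in> X \<Longrightarrow> x \<noteq> y \<Longrightarrow> R x y"
  shows "is_hnn_extension G (subgraph_group (X - {v})) (subgraph_group (X - {v}))"
proof -
  define A where "A = subgraph_group (X - {v})"
  have sub: "subgroup A G" unfolding A_def by (rule subgraph_group_subgroup) blast
  let ?GA = "G\<lparr>carrier := A\<rparr>"
  define S' where "S' = hnn_gens ?GA"
  define Q where "Q = hnn_rels ?GA A (\<lambda>a. a)"
  let ?P = "presented_group S' Q"
  interpret P: group ?P by (rule group_presented_group)
  have grp: "group ?GA" using subgroup_imp_group[OF sub] .
  have S'_eq: "S' = insert None (Some ` A)" by (simp add: S'_def hnn_gens_def)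
  note carr = subgroup.mem_carrier[OF sub]
  have "carrier G \<subseteq> subgraph_group X"
    by (rule generates[OF subgraph_group_subgroup]) (auto intro: gen_in_subgraph_group)
  then have abelian: "g \<otimes>\<^bsub>G\<^esub> h = h \<otimes>\<^bsub>G\<^esub> g" if "g \<in> carrier G" "h \<in> carrier G" for g h
    using that complete by (intro generate_clique_abelian[of X]) auto
  let ?i = "\<lambda>a. pres_gen S' Q (Some a)" and ?t = "pres_gen S' Q None"
  have i_hom: "?i \<in> hom ?GA ?P"
    by (rule mult_table_hom[OF grp]) (auto simp: Q_def hnn_rels_def S'_eq)
  have closed: "?t \<in> carrier ?P" "a \<in> A \<Longrightarrow> ?i a \<in> carrier ?P" for a
    by (auto intro!: pres_gen_closed simp: S'_eq)
  have t_comm: "?t \<otimes>\<^bsub>?P\<^esub> ?i a = ?i a \<otimes>\<^bsub>?P\<^esub> ?t" if a: "a \<in> A" for a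
  proof -
    have "[(None, True), (Some a, True), (None, False), (Some a, False)] \<in> Q \<inter> words S'"
      using a by (auto simp: Q_def hnn_rels_def S'_eq)
    then have "word_val ?P (pres_gen S' Q) [(None, True), (Some a, True), (None, False), (Some a, False)] = \<one>\<^bsub>?P\<^esub>"
      by (rule relator_trivial)
    then show ?thesis using P.word_val_commutator[of "pres_gen S' Q" None "Some a"] closed a by (simp del: word_val.simps)
  qed
  define f where "f = case_option (gen v) (\<lambda>a. a)"
  obtain \<phi> where \<phi>: "\<phi> \<in> hom ?P G" and \<phi>x: "\<And>x. x \<in> S' \<Longrightarrow> \<phi> (pres_gen S' Q x) = f x"
  proof (rule presented_group_lift[of f S' Q])
    show "f \<in> S' \<rightarrow> carrier G" using carr v by (auto simp: S'_eq f_def)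
    fix r assume "r \<in> Q \<inter> words S'"
    then consider "r \<in> mult_table Some ?GA"
      | c where "c \<in> A" "r = [(None, True), (Some c, True), (None, False), (Some c, False)]"
      by (auto simp: Q_def hnn_rels_def)
    then show "word_val G f r = \<one>\<^bsub>G\<^esub>"
    proof cases
      case 1
      show ?thesis by (rule word_val_mult_table[OF grp _ 1]) (use carr in \<open>auto simp: hom_def f_def\<close>)
    next
      case 2
      then have "f None \<in> carrier G" "f (Some c) \<in> carrier G" using carr v by (auto simp: f_def)
      then show ?thesis
        unfolding 2(2) using word_val_commutator[of f None "Some c"] abelian by blast
    qed
  qed blast
  define s where "s x = (if x = v then ?t else ?i (gen x))" for x
  have gA: "gen x \<in> A" if "x \<in> X" "x \<noteq> v" for x
    unfolding A_def by (rule gen_in_subgraph_group) (use that in blast)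
  have "s x \<in> carrier ?P" if "x \<in> X" for x using that closed gA by (simp add: s_def)
  moreover have "s x \<otimes>\<^bsub>?P\<^esub> s y = s y \<otimes>\<^bsub>?P\<^esub> s x" if xy: "x \<in> X" "y \<in> X" "R x y" for x y
  proof -
    have "?i (gen x) \<otimes>\<^bsub>?P\<^esub> ?i (gen y) = ?i (gen y) \<otimes>\<^bsub>?P\<^esub> ?i (gen x)" if "x \<noteq> v" "y \<noteq> v"
      using hom_mult[OF i_hom, of "gen x" "gen y"] hom_mult[OF i_hom, of "gen y" "gen x"]
        gA xy that abelian[of "gen x" "gen y"] by simp
    then show ?thesis using t_comm[OF gA] xy by (auto simp: s_def)
  qed
  ultimately obtain \<psi> where \<psi>: "\<psi> \<in> hom G ?P" and \<psi>x: "\<And>x. x \<in> X \<Longrightarrow> \<psi> (gen x) = s x"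
    using lift[OF P.is_group, of s] by blast
  have \<psi>A: "\<psi> a = ?i a" if "a \<in> A" for a
  proof (rule hom_eq_on_generate[OF P.is_group, of "gen ` (X - {v})"])
    show "gen ` (X - {v}) \<subseteq> carrier G" by auto
    show "\<psi> \<in> hom (G\<lparr>carrier := subgraph_group (X - {v})\<rparr>) ?P"
      using \<psi> carr unfolding A_def[symmetric] by (auto simp: hom_def)
    show "?i \<in> hom (G\<lparr>carrier := subgraph_group (X - {v})\<rparr>) ?P" using i_hom unfolding A_def .
    show "\<psi> y = ?i y" if "y \<in> gen ` (X - {v})" for y
      using that \<psi>x by (auto simp: s_def)
  qed (use that A_def in simp)
  have \<phi>i: "\<phi> (?i a) = a" if "a \<in> A" for a using that \<phi>x[of "Some a"] by (simp add: S'_eq f_def)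
  have \<phi>t: "\<phi> ?t = gen v" using \<phi>x[of None] by (simp add: S'_eq f_def)
  have iso: "\<phi> \<in> iso ?P G"
  proof (rule presented_group_isoI[OF is_group \<phi> \<psi>, of "gen ` X"])
    show "\<psi> (\<phi> (pres_gen S' Q x)) = pres_gen S' Q x" if "x \<in> S'" for x
      using that \<phi>i \<phi>t \<psi>A \<psi>x[OF v] by (auto simp: S'_eq s_def)
    show "\<phi> (\<psi> y) = y" if y: "y \<in> gen ` X" for y
    proof -
      obtain x where x: "x \<in> X" "y = gen x" using y by blast
      then show ?thesis using \<psi>x \<phi>t \<phi>i gA by (cases "x = v") (simp_all add: s_def)
    qed
  qed (use generates in auto)
  have mon: "(\<lambda>a. a) \<in> mon ?GA ?GA" by (simp add: mon_def hom_def subgroup.m_closed[OF sub])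
  show ?thesis
    unfolding is_hnn_extension_def Let_def A_def[symmetric]
    by (intro conjI sub order_refl bexI[OF _ mon] bexI[OF _ iso[unfolded S'_def Q_def]] ballI
        \<phi>i[unfolded S'_def Q_def])
qed

theorem splits_over_abelian_iff:
  assumes X: "finite X" "X \<noteq> {}"
  shows "splits_over_abelian G \<longleftrightarrow>
    (\<forall>x\<in>X. \<forall>y\<in>X. x \<noteq> y \<longrightarrow> R x y) \<or> (\<exists>K S T. clique_cut X R K S T)"
proof
  assume split: "splits_over_abelian G"
  show "(\<forall>x\<in>X. \<forall>y\<in>X. x \<noteq> y \<longrightarrow> R x y) \<or> (\<exists>K S T. clique_cut X R K S T)"
  proof (rule ccontr)
    assume neg: "\<not> ?thesis"
    then obtain x y where xy: "x \<in> X" "y \<in> X" "x \<noteq> y" "\<not> R x y" by blast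
    obtain C D where T: "abelian_tree_action G ((\<lambda>g. g <#\<^bsub>G\<^esub> C) ` carrier G) (l_coset G) C D"
      and nofix: "\<And>p. p \<in> cut_action.V G (l_coset G) C D \<Longrightarrow>
        \<exists>g\<in>carrier G. cut_action.mv (l_coset G) D g p \<noteq> p"
      using splitting_acts_on_tree[OF split] by blast
    interpret T: abelian_tree_action G "(\<lambda>g. g <#\<^bsub>G\<^esub> C) ` carrier G" "l_coset G" C D by (rule T)
    have "\<exists>p\<in>T.V. \<forall>g\<in>carrier G. T.mv g p = p"
      by (rule T.global_fixed_vertex[of X gen R x y])
        (use X neg xy generates gen_commute powers_not_commute R_sym R_irrefl in \<open>auto\<close>)
    then show False using nofix by blast
  qed
next
  assume "(\<forall>x\<in>X. \<forall>y\<in>X. x \<noteq> y \<longrightarrow> R x y) \<or> (\<exists>K S T. clique_cut X R K S T)"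
  then show "splits_over_abelian G"
  proof (elim disjE exE)
    assume c: "\<forall>x\<in>X. \<forall>y\<in>X. x \<noteq> y \<longrightarrow> R x y"
    obtain v where v: "v \<in> X" using X by blast
    have "is_hnn_extension G (subgraph_group (X - {v})) (subgraph_group (X - {v}))"
      using complete_graph_splitting[OF v] c by blast
    moreover have "comm_group (G\<lparr>carrier := subgraph_group (X - {v})\<rparr>)"
      using c by (intro comm_group_generate_clique) auto
    ultimately show ?thesis
      unfolding splits_over_abelian_def using subgraph_group_subgroup[of "X - {v}"] by blast
  next
    fix K S T assume cut: "clique_cut X R K S T"
    then obtain a b where ab: "a \<in> S" "b \<in> T" "a \<in> X" "b \<in> X" "a \<notin> K" "b \<notin> K" "K \<subseteq> X"
      unfolding clique_cut_def by blast
    have "subgraph_group K \<noteq> subgraph_group (K \<union> S)" "subgraph_group K \<noteq> subgraph_group (K \<union> T)"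
      using gen_notin_generate[of a K] gen_notin_generate[of b K] ab
        gen_in_subgraph_group[of a "K \<union> S"] gen_in_subgraph_group[of b "K \<union> T"] by auto
    moreover have "comm_group (G\<lparr>carrier := subgraph_group K\<rparr>)"
      using cut ab by (intro comm_group_generate_clique) (auto simp: clique_cut_def)
    ultimately show ?thesis
      unfolding splits_over_abelian_def
      using clique_cut_splitting[OF cut] subgraph_group_subgroup[of K] ab by blast
  qed
qed

end

section \<open>From graphs to presentations\<close>

context graph
begin

lemma complete_graph_induced_iff:
  assumes "K \<subseteq> verts G"
  shows "complete_graph (G \<restriction> K) \<longleftrightarrow> (\<forall>x\<in>K. \<forall>y\<in>K. x \<noteq> y \<longrightarrow> x \<rightarrow>\<^bsub>G\<^esub> y)"
proof -
  have "digraph (G \<restriction> K)"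
    using assms finite_subset[OF assms] no_loops no_multi_arcs by unfold_locales auto
  moreover have "sym_digraph (G \<restriction> K)"
    using induced_graph_imp_graph induced_induce assms by blast
  ultimately have "graph (G \<restriction> K)"
    by (simp add: graph_def pseudo_graph_def digraph_def)
  moreover have "arcs_ends (G \<restriction> K) = {(u, v). u \<in> K \<and> v \<in> K \<and> u \<rightarrow>\<^bsub>G\<^esub> v}"
    by (auto simp: arcs_ends_conv)
  ultimately have "complete_graph (G \<restriction> K) \<longleftrightarrow>
      {(u, v). u \<in> K \<and> v \<in> K \<and> u \<rightarrow>\<^bsub>G\<^esub> v} = {(u, v). u \<in> K \<and> v \<in> K \<and> u \<noteq> v}"
    unfolding complete_graph_def complete_digraph_def by simp
  moreover have "\<not> u \<rightarrow>\<^bsub>G\<^esub> u" for u by (auto dest: adj_not_same)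
  then have "{(u, v). u \<in> K \<and> v \<in> K \<and> u \<rightarrow>\<^bsub>G\<^esub> v} = {(u, v). u \<in> K \<and> v \<in> K \<and> u \<noteq> v} \<longleftrightarrow>
      (\<forall>x\<in>K. \<forall>y\<in>K. x \<noteq> y \<longrightarrow> x \<rightarrow>\<^bsub>G\<^esub> y)"
    by (simp add: set_eq_iff) blast
  ultimately show ?thesis by blast
qed

lemma disconnected_induced_iff:
  assumes "Y \<subseteq> verts G"
  shows "disconnected (G \<restriction> Y) \<longleftrightarrow> (\<exists>S T. S \<noteq> {} \<and> T \<noteq> {} \<and> S \<inter> T = {} \<and> S \<union> T = Y \<and>
    (\<forall>u\<in>S. \<forall>v\<in>T. \<not> u \<rightarrow>\<^bsub>G\<^esub> v))"
proof -
  interpret Y: sym_digraph "G \<restriction> Y"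
    using induced_graph_imp_graph induced_induce assms by blast
  have dom: "u \<rightarrow>\<^bsub>G \<restriction> Y\<^esub> v \<longleftrightarrow> u \<in> Y \<and> v \<in> Y \<and> u \<rightarrow>\<^bsub>G\<^esub> v" for u v
    by (auto simp: arcs_ends_conv)
  show ?thesis
    unfolding Y.disconnected_iff induce_subgraph_verts
    by (intro iff_exI conj_cong refl) (use dom in blast)
qed

lemma induce_all: "G \<restriction> verts G = G"
  by (rule pre_digraph.equality) auto

text \<open>
  A cut with \<open>K = {}\<close> disconnects the graph; any other cut makes \<open>K\<close> a separating clique.
\<close>
lemma clique_cut_iff:
  "(\<exists>K S T. clique_cut (verts G) (\<lambda>u v. u \<rightarrow>\<^bsub>G\<^esub> v) K S T) \<longleftrightarrow>
    disconnected G \<or> (\<exists>K. separating_clique G K)"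
proof -
  have cut: "(\<exists>S T. clique_cut (verts G) (\<lambda>u v. u \<rightarrow>\<^bsub>G\<^esub> v) K S T) \<longleftrightarrow>
      K \<subseteq> verts G \<and> complete_graph (G \<restriction> K) \<and> disconnected (G \<restriction> (verts G - K))" for K
  proof
    assume "\<exists>S T. clique_cut (verts G) (\<lambda>u v. u \<rightarrow>\<^bsub>G\<^esub> v) K S T"
    then obtain S T where c: "clique_cut (verts G) (\<lambda>u v. u \<rightarrow>\<^bsub>G\<^esub> v) K S T" by blast
    then have K: "K \<subseteq> verts G" "S \<union> T = verts G - K" by (auto simp: clique_cut_def)
    moreover have "disconnected (G \<restriction> (verts G - K))"
      unfolding disconnected_induced_iff[OF Diff_subset]
      by (intro exI[of _ S] exI[of _ T] conjI) (use c K(2) in \<open>simp_all add: clique_cut_def\<close>)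
    ultimately show "K \<subseteq> verts G \<and> complete_graph (G \<restriction> K) \<and> disconnected (G \<restriction> (verts G - K))"
      using c unfolding clique_cut_def by (simp add: complete_graph_induced_iff)
  next
    assume r: "K \<subseteq> verts G \<and> complete_graph (G \<restriction> K) \<and> disconnected (G \<restriction> (verts G - K))"
    then obtain S T where ST: "S \<noteq> {}" "T \<noteq> {}" "S \<inter> T = {}" "S \<union> T = verts G - K"
      "\<forall>u\<in>S. \<forall>v\<in>T. \<not> u \<rightarrow>\<^bsub>G\<^esub> v"
      unfolding disconnected_induced_iff[OF Diff_subset] by blast
    moreover have "K \<union> S \<union> T = verts G" "K \<inter> S = {}" "K \<inter> T = {}" using ST(4) r by blast+
    ultimately have "clique_cut (verts G) (\<lambda>u v. u \<rightarrow>\<^bsub>G\<^esub> v) K S T"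
      using r complete_graph_induced_iff[of K] unfolding clique_cut_def by blast
    then show "\<exists>S T. clique_cut (verts G) (\<lambda>u v. u \<rightarrow>\<^bsub>G\<^esub> v) K S T" by blast
  qed
  have "complete_graph (G \<restriction> {})" by (simp add: complete_graph_induced_iff)
  then have empty: "(\<exists>S T. clique_cut (verts G) (\<lambda>u v. u \<rightarrow>\<^bsub>G\<^esub> v) {} S T) \<longleftrightarrow> disconnected G"
    unfolding cut by (simp add: induce_all)
  have nonempty: "(\<exists>S T. clique_cut (verts G) (\<lambda>u v. u \<rightarrow>\<^bsub>G\<^esub> v) K S T) \<and> K \<noteq> {} \<longleftrightarrow>
      separating_clique G K" for K
    unfolding cut separating_clique_def is_clique_def by blast
  show ?thesis
  proof
    assume "\<exists>K S T. clique_cut (verts G) (\<lambda>u v. u \<rightarrow>\<^bsub>G\<^esub> v) K S T"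
    then obtain K where "\<exists>S T. clique_cut (verts G) (\<lambda>u v. u \<rightarrow>\<^bsub>G\<^esub> v) K S T" by blast
    then show "disconnected G \<or> (\<exists>K. separating_clique G K)"
      using empty nonempty[of K] by (cases "K = {}") auto
  next
    assume "disconnected G \<or> (\<exists>K. separating_clique G K)"
    then show "\<exists>K S T. clique_cut (verts G) (\<lambda>u v. u \<rightarrow>\<^bsub>G\<^esub> v) K S T"
    proof
      assume "disconnected G"
      then show ?thesis using empty by blast
    next
      assume "\<exists>K. separating_clique G K"
      then obtain K where "separating_clique G K" by blast
      then show ?thesis using nonempty[of K] by blast
    qed
  qed
qed

end

theorem theorem1:
  fixes \<Gamma> :: "('v, 'e) pre_digraph"
  assumes "graph \<Gamma>" and "verts \<Gamma> \<noteq> {}"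
  shows "splits_over_abelian (raag \<Gamma>) \<longleftrightarrow>
    disconnected \<Gamma> \<or> complete_graph \<Gamma> \<or> (\<exists>K. separating_clique \<Gamma> K)"
proof -
  interpret graph \<Gamma> by (rule assms(1))
  interpret A: raa_group "verts \<Gamma>" "\<lambda>u v. u \<rightarrow>\<^bsub>\<Gamma>\<^esub> v" "raag \<Gamma>"
    by unfold_locales (auto simp: raag_def commutator_rels_def dest: graph_symmetric adj_not_same)
  have "complete_graph \<Gamma> \<longleftrightarrow> (\<forall>x\<in>verts \<Gamma>. \<forall>y\<in>verts \<Gamma>. x \<noteq> y \<longrightarrow> x \<rightarrow>\<^bsub>\<Gamma>\<^esub> y)"
    using complete_graph_induced_iff[of "verts \<Gamma>"] by (simp add: induce_all)
  then show ?thesis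
    using A.splits_over_abelian_iff[OF finite_verts assms(2)] clique_cut_iff by blast
qed

end
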